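(* Let $(K,\leq)$ be a partially ordered set, let $\{K_i \mid i\in I\}$ be the family of all maximal upward directed subsets of $K$, let $\tau$ be the topology on $I$ with base $\{U_a\mid a\in K\}$, where $U_a=\{i\in I\mid a\in K_i\}$, and let $\mathcal{F}=(K,\{\mathfrak{A}_a\},\{\sigma_{ba}\})$ be an inductive system of unital $C^*$-algebras over $K$ whose connecting maps are unital injective $*$-homomorphisms. Let $\mathfrak{A}^{K_i}$ and $\mathfrak{B}^{K_i}$ be the associated inductive limit $C^*$-algebras defined in the context. If $i\in I$ is an isolated point of the topological space $(I,\tau)$, then the $C^*$-algebras $\mathfrak{B}^{K_i}$ and $\mathfrak{A}^{K_i}$ are isomorphic.
   Context: A subset $S$ of a partially ordered set $(K,\leq)$ is upward directed if it is non-empty and any two elements of $S$ have an upper bound in $S$. $\{K_i\mid i\in I\}$ is the family of all maximal (with respect to inclusion) upward directed subsets of $K$, with $K_i\neq K_j$ for $i\neq j$; one has $K=\bigcup_{i\in I}K_i$. For $a\in K$ put $U_a=\{i\in I\mid a\in K_i\}$. If $a\leq b$ then $U_b\subseteq U_a$. The family $\{U_a\mid a\in K\}$ is a base of a topology $\tau$ on $I$. Inductive system: an inductive system of unital $C^*$-algebras over $K$ is a family $\{\mathfrak{A}_a\mid a\in K\}$ of unital $C^*$-algebras with unital $*$-homomorphisms $\sigma_{ba}:\mathfrak{A}_a\to\mathfrak{A}_b$ for all $a\leq b$ such that $\sigma_{aa}=\mathrm{id}$ and $\sigma_{ca}=\sigma_{cb}\circ\sigma_{ba}$ whenever $a\leq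 b\leq c$. Inductive limit: let $D$ be an upward directed set and $(D,\{\mathfrak{C}_a\},\{\rho_{ba}\})$ an inductive system of unital $C^*$-algebras over $D$. Let $\prod_{a\in D}\mathfrak{C}_a=\{(F_a)\mid \sup_a\|F_a\|<\infty\}$ with pointwise operations and supremum norm, and let $\Sigma$ be the closed two-sided ideal of all $(F_a)$ such that the net $\{\|F_a\|\}_{a\in D}$ converges to $0$. For $a\in D$ and $A\in\mathfrak{C}_a$ let $\theta_a(A)\in\prod_{b\in D}\mathfrak{C}_b$ be given by $[\theta_a(A)](b)=\rho_{ba}(A)$ if $a\leq b$ and $0$ otherwise, and let $\rho_a^{D}(A)=\theta_a(A)+\Sigma$. The inductive limit is the norm closure of $\bigcup_{a\in D}\rho_a^{D}(\mathfrak{C}_a)$ in $\prod_{a\in D}\mathfrak{C}_a/\Sigma$, together with the unital $*$-homomorphisms $\rho_a^{D}$. The algebra $\mathfrak{A}^{K_i}$ is the inductive limit of the restricted system $(K_i,\{\mathfrak{A}_a\}_{a\in K_i},\{\sigma_{ba}\})$. For $a\in K$ let $\mathfrak{B}_a=\prod_{i\in U_a}\mathfrak{A}^{K_i}$ (the $C^*$-algebra of norm-bounded families, supremum norm), and for $a\leq b$ let $\tau_{ba}:\mathfrak{B}_a\to\mathfrak{B}_b$ be the restriction map $\tau_{ba}(f)(j)=f(j)$, $j\in U_b$. Then $(K,\{\mathfrak{B}_a\},\{\tau_{ba}\})$ is an inductive system (the $\tau_{ba}$ need not be injective), and $\mathfrak{B}^{K_i}$ is the inductive limit of $(K_i,\{\mathfrak{B}_a\}_{a\in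 K_i},\{\tau_{ba}\})$. "Isomorphic" means $*$-isomorphic. *)

theory Defs
  imports
    "HOL-Analysis.Analysis"
    "HOL-Algebra.Module"
    "HOL-Algebra.QuotRing"
begin

section \<open>Unital C*-algebras with explicit carriers\<close>

text \<open>
  Families of C*-algebras indexed by a poset are families of records over one common type, with
  carriers depending on the index. The zero algebra is not excluded.
\<close>

definition complex_ring :: "complex ring" where
  "complex_ring = \<lparr>carrier = UNIV, mult = (*), one = 1, zero = 0, add = (+)\<rparr>"

record 'x cstar = "(complex, 'x) module" +
  adj :: "'x \<Rightarrow> 'x"
  nrm :: "'x \<Rightarrow> real"

text \<open>
  The locale \<^locale>\<open>Metric_space\<close> requires nonnegativity and symmetry on the whole type, hence the
  value 0 off the carrier.
\<close>

definition norm_dist :: "('x, 'm) cstar_scheme \<Rightarrow> 'x \<Rightarrow> 'x \<Rightarrow> real" where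
  "norm_dist A x y =
     (if x \<in> carrier A \<and> y \<in> carrier A then nrm A (x \<ominus>\<^bsub>A\<^esub> y) else 0)"

locale unital_cstar_algebra =
  fixes A :: "('x, 'm) cstar_scheme" (structure)
  assumes ring: "ring A"
    and module: "module complex_ring A"
    and smult_mult_left:
      "\<lbrakk>x \<in> carrier A; y \<in> carrier A\<rbrakk> \<Longrightarrow> (c \<odot> x) \<otimes> y = c \<odot> (x \<otimes> y)"
    and smult_mult_right:
      "\<lbrakk>x \<in> carrier A; y \<in> carrier A\<rbrakk> \<Longrightarrow> x \<otimes> (c \<odot> y) = c \<odot> (x \<otimes> y)"
    and adj_closed: "x \<in> carrier A \<Longrightarrow> adj A x \<in> carrier A"
    and adj_adj: "x \<in> carrier A \<Longrightarrow> adj A (adj A x) = x"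
    and adj_add:
      "\<lbrakk>x \<in> carrier A; y \<in> carrier A\<rbrakk> \<Longrightarrow> adj A (x \<oplus> y) = adj A x \<oplus> adj A y"
    and adj_smult: "x \<in> carrier A \<Longrightarrow> adj A (c \<odot> x) = cnj c \<odot> adj A x"
    and adj_mult:
      "\<lbrakk>x \<in> carrier A; y \<in> carrier A\<rbrakk> \<Longrightarrow> adj A (x \<otimes> y) = adj A y \<otimes> adj A x"
    and nrm_eq_0_iff: "x \<in> carrier A \<Longrightarrow> nrm A x = 0 \<longleftrightarrow> x = \<zero>"
    and nrm_smult: "x \<in> carrier A \<Longrightarrow> nrm A (c \<odot> x) = cmod c * nrm A x"
    and nrm_triangle:
      "\<lbrakk>x \<in> carrier A; y \<in> carrier A\<rbrakk> \<Longrightarrow> nrm A (x \<oplus> y) \<le> nrm A x + nrm A y"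
    and nrm_mult:
      "\<lbrakk>x \<in> carrier A; y \<in> carrier A\<rbrakk> \<Longrightarrow> nrm A (x \<otimes> y) \<le> nrm A x * nrm A y"
    and cstar_identity: "x \<in> carrier A \<Longrightarrow> nrm A (adj A x \<otimes> x) = (nrm A x)\<^sup>2"
    and complete: "Metric_space.mcomplete (carrier A) (norm_dist A)"

text \<open>
  Homomorphisms are unital, since \<^const>\<open>ring_hom\<close> includes preservation of the unit.
\<close>

definition star_hom ::
  "('x, 'm) cstar_scheme \<Rightarrow> ('y, 'n) cstar_scheme \<Rightarrow> ('x \<Rightarrow> 'y) set" where
  "star_hom A B = {h \<in> ring_hom A B.
     (\<forall>c. \<forall>x\<in>carrier A. h (c \<odot>\<^bsub>A\<^esub> x) = c \<odot>\<^bsub>B\<^esub> h x) \<and>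
     (\<forall>x\<in>carrier A. h (adj A x) = adj B (h x))}"

definition star_isomorphic ::
  "('x, 'm) cstar_scheme \<Rightarrow> ('y, 'n) cstar_scheme \<Rightarrow> bool" where
  "star_isomorphic A B \<longleftrightarrow> (\<exists>h \<in> star_hom A B. bij_betw h (carrier A) (carrier B))"


section \<open>Bounded products and quotients\<close>

text \<open>
  The supremum is only meaningful for a nonempty index set.
\<close>

definition cstar_prod :: "'i set \<Rightarrow> ('i \<Rightarrow> 'x cstar) \<Rightarrow> ('i \<Rightarrow> 'x) cstar" where
  "cstar_prod D C = \<lparr>
     carrier = {F \<in> (\<Pi>\<^sub>E a\<in>D. carrier (C a)). bdd_above ((\<lambda>a. nrm (C a) (F a)) ` D)},
     mult = (\<lambda>F G. \<lambda>a\<in>D. F a \<otimes>\<^bsub>C a\<^esub> G a),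
     one = (\<lambda>a\<in>D. \<one>\<^bsub>C a\<^esub>),
     zero = (\<lambda>a\<in>D. \<zero>\<^bsub>C a\<^esub>),
     add = (\<lambda>F G. \<lambda>a\<in>D. F a \<oplus>\<^bsub>C a\<^esub> G a),
     smult = (\<lambda>c F. \<lambda>a\<in>D. c \<odot>\<^bsub>C a\<^esub> F a),
     adj = (\<lambda>F. \<lambda>a\<in>D. adj (C a) (F a)),
     nrm = (\<lambda>F. SUP a\<in>D. nrm (C a) (F a))\<rparr>"

text \<open>
  The quotient by a closed two-sided ideal, with the usual quotient norm. The unions in the scalar
  multiplication and in the involution follow the pattern of \<^const>\<open>rcoset_mult\<close>.
\<close>

definition cstar_quot :: "('x, 'm) cstar_scheme \<Rightarrow> 'x set \<Rightarrow> 'x set cstar" where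
  "cstar_quot A J = \<lparr>
     carrier = carrier (A Quot J),
     mult = mult (A Quot J),
     one = one (A Quot J),
     zero = zero (A Quot J),
     add = add (A Quot J),
     smult = (\<lambda>c X. \<Union>x\<in>X. J +>\<^bsub>A\<^esub> (c \<odot>\<^bsub>A\<^esub> x)),
     adj = (\<lambda>X. \<Union>x\<in>X. J +>\<^bsub>A\<^esub> adj A x),
     nrm = (\<lambda>X. INF x\<in>X. nrm A x)\<rparr>"


section \<open>Directed sets, inductive systems and inductive limits\<close>

definition upward_directed :: "'k::order set \<Rightarrow> bool" where
  "upward_directed S \<longleftrightarrow> S \<noteq> {} \<and> (\<forall>a\<in>S. \<forall>b\<in>S. \<exists>c\<in>S. a \<le> c \<and> b \<le> c)"

definition maximal_directed :: "'k::order set \<Rightarrow> bool" where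
  "maximal_directed S \<longleftrightarrow>
     upward_directed S \<and> (\<forall>T. upward_directed T \<and> S \<subseteq> T \<longrightarrow> T = S)"

text \<open>
  The connecting map from the algebra at \<open>a\<close> to the algebra at \<open>b\<close>, where \<open>a \<le> b\<close>, is \<open>\<rho> b a\<close>.
\<close>

definition inductive_system ::
  "'k::order set \<Rightarrow> ('k \<Rightarrow> 'x cstar) \<Rightarrow> ('k \<Rightarrow> 'k \<Rightarrow> 'x \<Rightarrow> 'x) \<Rightarrow> bool" where
  "inductive_system D C \<rho> \<longleftrightarrow>
     (\<forall>a\<in>D. unital_cstar_algebra (C a)) \<and>
     (\<forall>a\<in>D. \<forall>b\<in>D. a \<le> b \<longrightarrow> \<rho> b a \<in> star_hom (C a) (C b)) \<and>
     (\<forall>a\<in>D. \<forall>x\<in>carrier (C a). \<rho> a a x = x) \<and>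
     (\<forall>a\<in>D. \<forall>b\<in>D. \<forall>c\<in>D. a \<le> b \<longrightarrow> b \<le> c \<longrightarrow>
        (\<forall>x\<in>carrier (C a). \<rho> c a x = \<rho> c b (\<rho> b a x)))"

definition null_families :: "'k::order set \<Rightarrow> ('k \<Rightarrow> 'x cstar) \<Rightarrow> ('k \<Rightarrow> 'x) set" where
  "null_families D C = {F \<in> carrier (cstar_prod D C).
     \<forall>\<epsilon>>0. \<exists>a\<in>D. \<forall>b\<in>D. a \<le> b \<longrightarrow> \<bar>nrm (C b) (F b)\<bar> < \<epsilon>}"

definition limit_ambient :: "'k::order set \<Rightarrow> ('k \<Rightarrow> 'x cstar) \<Rightarrow> ('k \<Rightarrow> 'x) set cstar" where
  "limit_ambient D C = cstar_quot (cstar_prod D C) (null_families D C)"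

definition theta ::
  "'k::order set \<Rightarrow> ('k \<Rightarrow> 'x cstar) \<Rightarrow> ('k \<Rightarrow> 'k \<Rightarrow> 'x \<Rightarrow> 'x) \<Rightarrow> 'k \<Rightarrow> 'x \<Rightarrow> 'k \<Rightarrow> 'x" where
  "theta D C \<rho> a x = (\<lambda>b\<in>D. if a \<le> b then \<rho> b a x else \<zero>\<^bsub>C b\<^esub>)"

definition limit_map ::
  "'k::order set \<Rightarrow> ('k \<Rightarrow> 'x cstar) \<Rightarrow> ('k \<Rightarrow> 'k \<Rightarrow> 'x \<Rightarrow> 'x) \<Rightarrow> 'k \<Rightarrow> 'x \<Rightarrow> ('k \<Rightarrow> 'x) set" where
  "limit_map D C \<rho> a x = null_families D C +>\<^bsub>cstar_prod D C\<^esub> theta D C \<rho> a x"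

text \<open>
  The inductive limit has the operations and the norm of the ambient quotient, restricted to the
  closure of the union of the images.
\<close>

definition inductive_limit ::
  "'k::order set \<Rightarrow> ('k \<Rightarrow> 'x cstar) \<Rightarrow> ('k \<Rightarrow> 'k \<Rightarrow> 'x \<Rightarrow> 'x) \<Rightarrow> ('k \<Rightarrow> 'x) set cstar" where
  "inductive_limit D C \<rho> = (limit_ambient D C)\<lparr>carrier :=
     Metric_space.mtopology (carrier (limit_ambient D C)) (norm_dist (limit_ambient D C))
       closure_of (\<Union>a\<in>D. limit_map D C \<rho> a ` carrier (C a))\<rparr>"


section \<open>The index space of maximal directed subsets and the derived system\<close>

text \<open>
  The poset is a type of class \<^class>\<open>order\<close>; \<open>I\<close> is the index set and \<open>K i\<close> the maximal upward
  directed subset with index \<open>i\<close>.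
\<close>

definition index_nhd :: "'i set \<Rightarrow> ('i \<Rightarrow> 'k set) \<Rightarrow> 'k \<Rightarrow> 'i set" where
  "index_nhd I K a = {i \<in> I. a \<in> K i}"

definition index_topology :: "'i set \<Rightarrow> ('i \<Rightarrow> 'k set) \<Rightarrow> 'i topology" where
  "index_topology I K = topology (arbitrary union_of (\<lambda>S. S \<in> range (index_nhd I K)))"

definition limit_algebra ::
  "('k::order \<Rightarrow> 'x cstar) \<Rightarrow> ('k \<Rightarrow> 'k \<Rightarrow> 'x \<Rightarrow> 'x) \<Rightarrow> ('i \<Rightarrow> 'k set) \<Rightarrow> 'i \<Rightarrow> ('k \<Rightarrow> 'x) set cstar"
  where "limit_algebra A \<sigma> K i = inductive_limit (K i) A \<sigma>"

definition derived_algebra ::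
  "('k::order \<Rightarrow> 'x cstar) \<Rightarrow> ('k \<Rightarrow> 'k \<Rightarrow> 'x \<Rightarrow> 'x) \<Rightarrow> 'i set \<Rightarrow> ('i \<Rightarrow> 'k set) \<Rightarrow>
     'k \<Rightarrow> ('i \<Rightarrow> ('k \<Rightarrow> 'x) set) cstar" where
  "derived_algebra A \<sigma> I K a = cstar_prod (index_nhd I K a) (limit_algebra A \<sigma> K)"

definition derived_map ::
  "'i set \<Rightarrow> ('i \<Rightarrow> 'k set) \<Rightarrow> 'k \<Rightarrow> 'k \<Rightarrow> ('i \<Rightarrow> 'y) \<Rightarrow> ('i \<Rightarrow> 'y)" where
  "derived_map I K b a f = restrict f (index_nhd I K b)"

definition derived_limit_algebra ::
  "('k::order \<Rightarrow> 'x cstar) \<Rightarrow> ('k \<Rightarrow> 'k \<Rightarrow> 'x \<Rightarrow> 'x) \<Rightarrow> 'i set \<Rightarrow> ('i \<Rightarrow> 'k set) \<Rightarrow>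
     'i \<Rightarrow> ('k \<Rightarrow> 'i \<Rightarrow> ('k \<Rightarrow> 'x) set) set cstar" where
  "derived_limit_algebra A \<sigma> I K i =
     inductive_limit (K i) (derived_algebra A \<sigma> I K) (derived_map I K)"

text \<open>
  The sets \<^const>\<open>index_nhd\<close> do form the base of a topology on \<open>I\<close>, so that the use of
  \<^const>\<open>topology\<close> in \<^const>\<open>index_topology\<close> is justified.
\<close>

lemma maximal_directed_downward:
  assumes "maximal_directed S" "b \<in> S" "a \<le> b"
  shows "a \<in> S"
proof -
  have dir: "upward_directed S"
    and max: "\<And>T. upward_directed T \<Longrightarrow> S \<subseteq> T \<Longrightarrow> T = S"
    using assms(1) by (auto simp: maximal_directed_def)
  have ub: "\<exists>c\<in>S. x \<le> c" if "x \<in> insert a S" for x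
    using that assms(2,3) by auto
  have "upward_directed (insert a S)"
    unfolding upward_directed_def
  proof (intro conjI ballI)
    fix x y assume "x \<in> insert a S" "y \<in> insert a S"
    then obtain x' y' where xy: "x' \<in> S" "x \<le> x'" "y' \<in> S" "y \<le> y'"
      using ub by meson
    then obtain c where "c \<in> S" "x' \<le> c" "y' \<le> c"
      using dir unfolding upward_directed_def by meson
    with xy show "\<exists>c\<in>insert a S. x \<le> c \<and> y \<le> c"
      by (meson insertI2 order_trans)
  qed simp
  from max[OF this] show ?thesis by blast
qed

lemma
  fixes K :: "'i \<Rightarrow> 'k::order set"
  assumes K: "\<And>i. i \<in> I \<Longrightarrow> maximal_directed (K i)"
  shows openin_index_topology:
      "openin (index_topology I K) = arbitrary union_of (\<lambda>S. S \<in> range (index_nhd I K))"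
    and topspace_index_topology: "topspace (index_topology I K) = I"
proof -
  let ?P = "\<lambda>S. S \<in> range (index_nhd I K)"
  have "istopology (arbitrary union_of ?P)"
    unfolding istopology_base_eq
  proof (intro allI impI)
    fix S T assume "?P S \<and> ?P T"
    then obtain a b where S: "S = index_nhd I K a" and T: "T = index_nhd I K b"
      by auto
    have "S \<inter> T = \<Union> (index_nhd I K ` {c. a \<le> c \<and> b \<le> c})"
    proof (intro equalityI subsetI)
      fix i assume "i \<in> S \<inter> T"
      then have i: "i \<in> I" "a \<in> K i" "b \<in> K i"
        by (auto simp: S T index_nhd_def)
      then obtain c where "c \<in> K i" "a \<le> c" "b \<le> c"
        using K[OF i(1)] unfolding maximal_directed_def upward_directed_def by meson
      with i show "i \<in> \<Union> (index_nhd I K ` {c. a \<le> c \<and> b \<le> c})"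
        by (auto simp: index_nhd_def)
    next
      fix i assume "i \<in> \<Union> (index_nhd I K ` {c. a \<le> c \<and> b \<le> c})"
      then show "i \<in> S \<inter> T"
        using K maximal_directed_downward by (fastforce simp: S T index_nhd_def)
    qed
    then show "(arbitrary union_of ?P) (S \<inter> T)"
      by (auto simp: union_of_def arbitrary_def)
  qed
  then show *: "openin (index_topology I K) = arbitrary union_of ?P"
    unfolding index_topology_def by (rule topology_inverse')
  have "I = \<Union> (range (index_nhd I K))"
    using K by (force simp: index_nhd_def maximal_directed_def upward_directed_def)
  then have "openin (index_topology I K) I"
    unfolding * by (auto simp: union_of_def arbitrary_def)
  moreover have "U \<subseteq> I" if "openin (index_topology I K) U" for U
    using that unfolding * by (auto simp: union_of_def index_nhd_def)
  ultimately show "topspace (index_topology I K) = I"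
    unfolding topspace_def by blast
qed

end

theory Submission
  imports Defs "HOL-Algebra.Multiplicative_Group"
begin

text \<open>
  Since \<open>{i}\<close> is open, some basic set \<open>U\<^sub>a\<close> equals \<open>{i}\<close>. For \<open>b \<ge> a\<close> in \<open>K\<^sub>i\<close> the set
  \<open>U\<^sub>b \<subseteq> U\<^sub>a\<close> still contains \<open>i\<close>, so \<open>U\<^sub>b = {i}\<close> too: on the cofinal part of \<open>K\<^sub>i\<close> above \<open>a\<close> the
  derived system is constant, its algebras are products over the single index \<open>i\<close> and its
  restriction maps are identities. The limit of an eventually constant system is the algebra at
  which it becomes constant, here the product over \<open>{i}\<close> of the limit algebra at \<open>i\<close>, and
  evaluation at \<open>i\<close> identifies this product with the limit algebra itself.

  The analytic content is that the limit of such a system is no larger than one of its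
  algebras. The canonical map from the algebra at \<open>a\<close> into the quotient of the bounded product by the
  null families is isometric, because every tail of a constant family carries its whole norm, and
  its range is the union of all canonical images
  (\<open>inductive_limit_eventually_isometric\<close>). The inductive limit is the closure of this range, and an
  isometric image of a complete algebra is closed (\<open>isometric_image_closed\<close>). Hence the limit
  algebras must be known to be complete: completeness is carried through bounded products
  (\<open>banach_star_algebra_cstar_prod\<close>), quotients (\<open>banach_star_algebra_quot\<close>) and closed
  subalgebras (\<open>banach_star_algebra_restrict\<close>), which together build every inductive limit
  (\<open>banach_star_algebra_inductive_limit\<close>).

  All this takes place in the class of Banach *-algebras with isometric involution, in which the three
  constructions can be carried out by norm estimates alone. An inductive limit is
  described in it by the bounded families that eventually follow the connecting maps: they form a
  *-subalgebra of the bounded product whose image in the quotient is dense in the limit.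
\<close>

section \<open>Normed *-algebras with isometric involution\<close>

text \<open>
  This class lies between C*-algebras and normed *-algebras: the C*-identity is replaced by two
  of its consequences, the isometry of the involution and the bound on the norm of the unit. Both pass
  to quotients directly from the infimum in the quotient norm, whereas the C*-identity of a quotient
  requires approximate units. The unit has norm at most 1, not equal to 1, as the zero algebra is
  included; without this bound the constant family of units could be unbounded in an infinite product.
\<close>

locale normed_star_algebra =
  fixes A :: "('x, 'm) cstar_scheme" (structure)
  assumes ring: "ring A"
    and module: "module complex_ring A"
    and smult_mult_left:
      "\<lbrakk>x \<in> carrier A; y \<in> carrier A\<rbrakk> \<Longrightarrow> (c \<odot> x) \<otimes> y = c \<odot> (x \<otimes> y)"
    and smult_mult_right:
      "\<lbrakk>x \<in> carrier A; y \<in> carrier A\<rbrakk> \<Longrightarrow> x \<otimes> (c \<odot> y) = c \<odot> (x \<otimes> y)"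
    and adj_closed: "x \<in> carrier A \<Longrightarrow> adj A x \<in> carrier A"
    and adj_adj: "x \<in> carrier A \<Longrightarrow> adj A (adj A x) = x"
    and adj_add:
      "\<lbrakk>x \<in> carrier A; y \<in> carrier A\<rbrakk> \<Longrightarrow> adj A (x \<oplus> y) = adj A x \<oplus> adj A y"
    and adj_smult: "x \<in> carrier A \<Longrightarrow> adj A (c \<odot> x) = cnj c \<odot> adj A x"
    and adj_mult:
      "\<lbrakk>x \<in> carrier A; y \<in> carrier A\<rbrakk> \<Longrightarrow> adj A (x \<otimes> y) = adj A y \<otimes> adj A x"
    and nrm_eq_0_iff: "x \<in> carrier A \<Longrightarrow> nrm A x = 0 \<longleftrightarrow> x = \<zero>"
    and nrm_smult: "x \<in> carrier A \<Longrightarrow> nrm A (c \<odot> x) = cmod c * nrm A x"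
    and nrm_triangle:
      "\<lbrakk>x \<in> carrier A; y \<in> carrier A\<rbrakk> \<Longrightarrow> nrm A (x \<oplus> y) \<le> nrm A x + nrm A y"
    and nrm_mult:
      "\<lbrakk>x \<in> carrier A; y \<in> carrier A\<rbrakk> \<Longrightarrow> nrm A (x \<otimes> y) \<le> nrm A x * nrm A y"
    and nrm_adj: "x \<in> carrier A \<Longrightarrow> nrm A (adj A x) = nrm A x"
    and nrm_one_le: "nrm A \<one> \<le> 1"

sublocale normed_star_algebra \<subseteq> ring A
  by (rule ring)

lemma complex_ring_simps [simp]:
  "carrier complex_ring = UNIV" "mult complex_ring = (*)" "one complex_ring = 1"
  "zero complex_ring = 0" "add complex_ring = (+)"
  by (simp_all add: complex_ring_def)

lemma cring_complex_ring: "cring complex_ring"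
proof (intro cringI abelian_groupI comm_monoidI)
  fix x :: complex
  show "\<exists>y\<in>carrier complex_ring. y \<oplus>\<^bsub>complex_ring\<^esub> x = \<zero>\<^bsub>complex_ring\<^esub>"
    by (simp, rule exI[of _ "- x"], simp)
qed (auto simp: algebra_simps)

context normed_star_algebra
begin

lemma smult_closed [simp, intro]: "x \<in> carrier A \<Longrightarrow> c \<odot> x \<in> carrier A"
  using module.smult_closed[OF module, of c x] by simp

lemma smult_l_distr: "x \<in> carrier A \<Longrightarrow> (c + d) \<odot> x = c \<odot> x \<oplus> d \<odot> x"
  using module.smult_l_distr[OF module, of c d x] by simp

lemma smult_r_distr:
  "\<lbrakk>x \<in> carrier A; y \<in> carrier A\<rbrakk> \<Longrightarrow> c \<odot> (x \<oplus> y) = c \<odot> x \<oplus> c \<odot> y"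
  using module.smult_r_distr[OF module, of c x y] by simp

lemma smult_assoc: "x \<in> carrier A \<Longrightarrow> (c * d) \<odot> x = c \<odot> (d \<odot> x)"
  using module.smult_assoc1[OF module, of c d x] by simp

lemma smult_one [simp]: "x \<in> carrier A \<Longrightarrow> 1 \<odot> x = x"
  using module.smult_one[OF module, of x] by simp

lemma smult_zero_left [simp]: "x \<in> carrier A \<Longrightarrow> 0 \<odot> x = \<zero>"
  using module.smult_l_null[OF module, of x] by simp

lemma smult_minus_one: "x \<in> carrier A \<Longrightarrow> (- 1) \<odot> x = \<ominus> x"
  using smult_l_distr[of x "- 1" 1] by (simp add: minus_equality)

lemma nrm_zero [simp]: "nrm A \<zero> = 0"
  by (simp add: nrm_eq_0_iff)

lemma nrm_minus [simp]: "x \<in> carrier A \<Longrightarrow> nrm A (\<ominus> x) = nrm A x"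
  using nrm_smult[of x "- 1"] by (simp add: smult_minus_one)

lemma nrm_nonneg [simp]: "x \<in> carrier A \<Longrightarrow> 0 \<le> nrm A x"
  using nrm_triangle[of x "\<ominus> x"] by (simp add: r_neg)

lemma smult_minus: "\<lbrakk>x \<in> carrier A; y \<in> carrier A\<rbrakk> \<Longrightarrow> c \<odot> (x \<ominus> y) = c \<odot> x \<ominus> c \<odot> y"
  by (simp add: a_minus_def smult_r_distr smult_minus_one [symmetric] smult_assoc [symmetric]
      mult.commute)

lemma adj_minus:
  "\<lbrakk>x \<in> carrier A; y \<in> carrier A\<rbrakk> \<Longrightarrow> adj A (x \<ominus> y) = adj A x \<ominus> adj A y"
  by (simp add: a_minus_def adj_add adj_closed smult_minus_one [symmetric] adj_smult)

lemma minus_self [simp]: "x \<in> carrier A \<Longrightarrow> x \<ominus> x = \<zero>"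
  by (simp add: a_minus_def r_neg)

lemma nrm_minus_commute:
  assumes "x \<in> carrier A" "y \<in> carrier A"
  shows "nrm A (x \<ominus> y) = nrm A (y \<ominus> x)"
proof -
  have "y \<ominus> x = \<ominus> (x \<ominus> y)"
    using assms by algebra
  then show ?thesis
    using assms by simp
qed

lemma nrm_triangle_minus:
  assumes "x \<in> carrier A" "y \<in> carrier A" "z \<in> carrier A"
  shows "nrm A (x \<ominus> z) \<le> nrm A (x \<ominus> y) + nrm A (y \<ominus> z)"
proof -
  have "x \<ominus> z = (x \<ominus> y) \<oplus> (y \<ominus> z)"
    using assms by algebra
  then show ?thesis
    using assms nrm_triangle by simp
qed

lemma nrm_minus_le:
  assumes "x \<in> carrier A" "y \<in> carrier A"
  shows "nrm A x \<le> nrm A (x \<ominus> y) + nrm A y"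
  using nrm_triangle_minus[of x y \<zero>] assms by (simp add: a_minus_def)

lemma Metric_space_norm_dist: "Metric_space (carrier A) (norm_dist A)"
proof
  show "norm_dist A x z \<le> norm_dist A x y + norm_dist A y z"
    if "x \<in> carrier A" "y \<in> carrier A" "z \<in> carrier A" for x y z
    using that nrm_triangle_minus by (simp add: norm_dist_def)
  show "norm_dist A x y = 0 \<longleftrightarrow> x = y" if "x \<in> carrier A" "y \<in> carrier A" for x y
    using that nrm_eq_0_iff[of "x \<ominus> y"] by (simp add: norm_dist_def)
qed (auto simp: norm_dist_def nrm_minus_commute)

sublocale metr: Metric_space "carrier A" "norm_dist A"
  by (rule Metric_space_norm_dist)

lemma norm_dist_eq:
  "\<lbrakk>x \<in> carrier A; y \<in> carrier A\<rbrakk> \<Longrightarrow> norm_dist A x y = nrm A (x \<ominus> y)"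
  by (simp add: norm_dist_def)

lemma limitin_norm:
  assumes "\<And>n. s n \<in> carrier A"
  shows "limitin metr.mtopology s l sequentially \<longleftrightarrow>
    l \<in> carrier A \<and> (\<lambda>n. nrm A (s n \<ominus> l)) \<longlonglongrightarrow> 0"
  using assms by (auto simp: metr.limitin_metric_dist_null norm_dist_eq)

lemma MCauchy_geometric:
  assumes s: "\<And>n. s n \<in> carrier A"
    and step: "\<And>n. nrm A (s (Suc n) \<ominus> s n) \<le> (1/2) ^ n"
  shows "metr.MCauchy s"
proof -
  have bound: "nrm A (s (n + k) \<ominus> s n) \<le> 2 * (1/2) ^ n - 2 * (1/2) ^ (n + k)" for n k
  proof (induction k)
    case 0
    then show ?case using r_right_minus_eq[OF s s, of n n] by simp
  next
    case (Suc k)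
    have "nrm A (s (n + Suc k) \<ominus> s n)
        \<le> nrm A (s (Suc (n + k)) \<ominus> s (n + k)) + nrm A (s (n + k) \<ominus> s n)"
      using nrm_triangle_minus[OF s s s] by simp
    also have "\<dots> \<le> (1/2) ^ (n + k) + (2 * (1/2) ^ n - 2 * (1/2) ^ (n + k))"
      using Suc step[of "n + k"] by linarith
    finally show ?case by (simp add: field_simps)
  qed
  have le: "nrm A (s m \<ominus> s n) \<le> 2 * (1/2) ^ n" if "n \<le> m" for m n
    using bound[of n "m - n"] that by (smt (verit) le_add_diff_inverse zero_le_power divide_nonneg_pos)
  have close: "\<exists>N. \<forall>m n. N \<le> m \<longrightarrow> N \<le> n \<longrightarrow> norm_dist A (s m) (s n) < \<epsilon>" if "\<epsilon> > 0" for \<epsilon>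
  proof -
    obtain N where N: "(1/2::real) ^ N < \<epsilon> / 4"
      using real_arch_pow_inv[of "\<epsilon> / 4" "1/2"] \<open>\<epsilon> > 0\<close> by auto
    have "norm_dist A (s m) (s n) < \<epsilon>" if "N \<le> m" "N \<le> n" for m n
    proof -
      have "nrm A (s m \<ominus> s n) \<le> nrm A (s m \<ominus> s N) + nrm A (s N \<ominus> s n)"
        by (rule nrm_triangle_minus[OF s s s])
      also have "\<dots> \<le> 4 * (1/2) ^ N"
        using le[OF that(1)] le[OF that(2)] nrm_minus_commute[OF s s, of N n] by simp
      finally show ?thesis
        using N s by (simp add: norm_dist_eq)
    qed
    then show ?thesis by blast
  qed
  then show ?thesis
    using s by (auto simp: metr.MCauchy_def)
qed

text \<open>
  Testing completeness on sequences with geometrically small steps suits quotients: the steps can be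
  lifted one by one to representatives of nearly the same norm, whose sum then converges.
\<close>

lemma mcompleteI_geometric:
  assumes lim: "\<And>s. \<lbrakk>\<And>n. s n \<in> carrier A; \<And>n. nrm A (s (Suc n) \<ominus> s n) < (1/2) ^ n\<rbrakk>
      \<Longrightarrow> \<exists>l. limitin metr.mtopology s l sequentially"
  shows "metr.mcomplete"
  unfolding metr.mcomplete_def
proof (intro allI impI)
  fix s assume cau: "metr.MCauchy s"
  then have s: "s n \<in> carrier A" for n
    by (auto simp: metr.MCauchy_def)
  have "\<forall>k. \<exists>N. \<forall>m n. N \<le> m \<longrightarrow> N \<le> n \<longrightarrow> norm_dist A (s m) (s n) < (1/2) ^ k"
    using cau by (simp add: metr.MCauchy_def)
  then obtain N where N: "\<And>k m n. \<lbrakk>N k \<le> m; N k \<le> n\<rbrakk> \<Longrightarrow> norm_dist A (s m) (s n) < (1/2) ^ k"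
    by metis
  \<comment> \<open>The maximum makes \<open>r\<close> strictly increasing and keeps \<open>N k \<le> r k\<close>.\<close>
  define r where "r = rec_nat (N 0) (\<lambda>k q. max (Suc q) (N (Suc k)))"
  have r_Suc: "r (Suc k) = max (Suc (r k)) (N (Suc k))" for k
    by (simp add: r_def)
  have mono: "strict_mono r"
    using r_Suc by (simp add: strict_mono_Suc_iff less_max_iff_disj)
  have N_le: "N k \<le> r k" for k
    by (cases k) (simp_all add: r_def)
  have "nrm A ((s \<circ> r) (Suc k) \<ominus> (s \<circ> r) k) < (1/2) ^ k" for k
    using N[of k "r (Suc k)" "r k"] N_le[of k] s r_Suc[of k] by (simp add: norm_dist_eq)
  then obtain l where "limitin metr.mtopology (s \<circ> r) l sequentially"
    using lim[of "s \<circ> r"] s by auto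
  then show "\<exists>l. limitin metr.mtopology s l sequentially"
    using metr.MCauchy_convergent_subsequence[OF cau mono] by blast
qed

end

locale banach_star_algebra = normed_star_algebra +
  assumes complete: "metr.mcomplete"

lemma (in unital_cstar_algebra) nrm_adj:
  assumes x: "x \<in> carrier A"
  shows "nrm A (adj A x) = nrm A x"
proof -
  interpret ring A by (rule ring)
  interpret module complex_ring A by (rule module)
  have nonneg: "0 \<le> nrm A y" if "y \<in> carrier A" for y
  proof -
    have "(- 1) \<odot> y \<in> carrier A" "y \<oplus> (- 1) \<odot> y = \<zero>"
      using that smult_l_distr[of 1 "- 1" y] smult_closed[of "- 1" y] smult_one[of y]
        smult_l_null[of y] by auto
    then show ?thesis
      using nrm_triangle[of y "(- 1) \<odot> y"] nrm_smult[of y "- 1"] nrm_eq_0_iff[of \<zero>] that by simp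
  qed
  have le: "nrm A y \<le> nrm A (adj A y)" if y: "y \<in> carrier A" for y
  proof (cases "nrm A y = 0")
    case False
    have "nrm A y * nrm A y \<le> nrm A (adj A y) * nrm A y"
      using cstar_identity[OF y] nrm_mult[OF adj_closed[OF y] y] by (simp add: power2_eq_square)
    then show ?thesis
      using False nonneg[OF y] by simp
  qed (use nonneg[OF adj_closed[OF y]] in simp)
  show ?thesis
    using le[OF x] le[OF adj_closed[OF x]] by (simp add: adj_adj x)
qed

lemma (in unital_cstar_algebra) nrm_one_le: "nrm A \<one> \<le> 1"
proof -
  interpret ring A by (rule ring)
  have "adj A \<one> = \<one>"
    using adj_mult[of "adj A \<one>" \<one>] by (simp add: adj_closed adj_adj)
  then have "nrm A \<one> = (nrm A \<one>)\<^sup>2"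
    using cstar_identity[of \<one>] by simp
  then show ?thesis
    by (auto simp: power2_eq_square)
qed

sublocale unital_cstar_algebra \<subseteq> banach_star_algebra
proof (intro banach_star_algebra.intro normed_star_algebra.intro banach_star_algebra_axioms.intro)
qed (fact ring module smult_mult_left smult_mult_right adj_closed adj_adj adj_add adj_smult
    adj_mult nrm_eq_0_iff nrm_smult nrm_triangle nrm_mult nrm_adj nrm_one_le complete)+

section \<open>Closed *-subalgebras\<close>

locale star_subalgebra = normed_star_algebra +
  fixes S
  assumes subset: "S \<subseteq> carrier A"
    and one_mem: "\<one> \<in> S"
    and add_mem: "\<lbrakk>x \<in> S; y \<in> S\<rbrakk> \<Longrightarrow> x \<oplus> y \<in> S"
    and mult_mem: "\<lbrakk>x \<in> S; y \<in> S\<rbrakk> \<Longrightarrow> x \<otimes> y \<in> S"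
    and smult_mem: "x \<in> S \<Longrightarrow> c \<odot> x \<in> S"
    and adj_mem: "x \<in> S \<Longrightarrow> adj A x \<in> S"
begin

lemma zero_mem: "\<zero> \<in> S"
  using smult_mem[OF one_mem, of 0] by simp

lemma minus_mem: "x \<in> S \<Longrightarrow> \<ominus> x \<in> S"
  using smult_mem[of x "- 1"] subset by (auto simp: smult_minus_one)

lemma normed_star_algebra_restrict: "normed_star_algebra (A\<lparr>carrier := S\<rparr>)"
proof -
  have mem: "x \<in> carrier A" if "x \<in> S" for x
    using that subset by blast
  have group: "abelian_group (A\<lparr>carrier := S\<rparr>)"
  proof (rule abelian_groupI)
    fix x assume "x \<in> carrier (A\<lparr>carrier := S\<rparr>)"
    then show "\<exists>y\<in>carrier (A\<lparr>carrier := S\<rparr>). y \<oplus>\<^bsub>A\<lparr>carrier := S\<rparr>\<^esub> x = \<zero>\<^bsub>A\<lparr>carrier := S\<rparr>\<^esub>"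
      using minus_mem mem by (auto intro!: bexI[of _ "\<ominus> x"] simp: l_neg)
  qed (use zero_mem add_mem mem a_assoc in \<open>auto intro: a_comm\<close>)
  have ring: "ring (A\<lparr>carrier := S\<rparr>)"
    by (intro ringI group monoidI) (auto simp: one_mem mult_mem mem m_assoc l_distr r_distr)
  have module: "module complex_ring (A\<lparr>carrier := S\<rparr>)"
    by (intro moduleI cring_complex_ring group)
      (auto simp: smult_mem mem smult_l_distr smult_r_distr smult_assoc)
  show ?thesis
    by (intro normed_star_algebra.intro ring module)
      (auto simp: mem smult_mult_left smult_mult_right adj_mem adj_adj adj_add adj_smult adj_mult
        nrm_eq_0_iff nrm_smult nrm_triangle nrm_mult nrm_adj nrm_one_le)
qed

text \<open>
  The negative in a restricted record is selected from the smaller carrier, so its agreement with the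
  ambient negative needs an argument; both are the multiple by \<open>- 1\<close>.
\<close>

lemma minus_restrict:
  assumes "x \<in> S" "y \<in> S"
  shows "x \<ominus>\<^bsub>A\<lparr>carrier := S\<rparr>\<^esub> y = x \<ominus> y"
proof -
  interpret sub: normed_star_algebra "A\<lparr>carrier := S\<rparr>"
    by (rule normed_star_algebra_restrict)
  have "\<ominus>\<^bsub>A\<lparr>carrier := S\<rparr>\<^esub> y = \<ominus> y"
    using sub.smult_minus_one[of y] smult_minus_one[of y] assms subset by auto
  then show ?thesis
    by (simp add: a_minus_def)
qed

lemma banach_star_algebra_restrict:
  assumes complete: "metr.mcomplete" and closed: "closedin metr.mtopology S"
  shows "banach_star_algebra (A\<lparr>carrier := S\<rparr>)"
proof -
  interpret sub: normed_star_algebra "A\<lparr>carrier := S\<rparr>"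
    by (rule normed_star_algebra_restrict)
  have mem: "x \<in> carrier A" if "x \<in> S" for x
    using that subset by blast
  have dist: "norm_dist (A\<lparr>carrier := S\<rparr>) x y = norm_dist A x y" if "x \<in> S" "y \<in> S" for x y
    using that mem by (simp add: norm_dist_def minus_restrict)
  have "sub.metr.mcomplete"
    unfolding sub.metr.mcomplete_def
  proof (intro allI impI)
    fix s assume cau: "sub.metr.MCauchy s"
    then have s: "s n \<in> S" for n
      unfolding sub.metr.MCauchy_def by auto
    have "metr.MCauchy s"
      using cau s mem dist unfolding metr.MCauchy_def sub.metr.MCauchy_def
      by (auto simp: image_subset_iff)
    then obtain l where l: "limitin metr.mtopology s l sequentially"
      using complete unfolding metr.mcomplete_def by blast
    have "l \<in> S"
      using closed l s unfolding metr.metric_closedin_iff_sequentially_closed by blast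
    then have "limitin sub.metr.mtopology s l sequentially"
      using sub.limitin_norm[of s l] limitin_norm[of s l] l s mem by (simp add: minus_restrict)
    then show "\<exists>l. limitin sub.metr.mtopology s l sequentially" ..
  qed
  then show ?thesis
    by (intro banach_star_algebra.intro banach_star_algebra_axioms.intro sub.normed_star_algebra_axioms)
qed

end

context normed_star_algebra
begin

lemma in_closure_of_sequence:
  "x \<in> metr.mtopology closure_of S \<longleftrightarrow>
    x \<in> carrier A \<and> (\<exists>s. (\<forall>n. s n \<in> S \<inter> carrier A) \<and> (\<lambda>n. nrm A (s n \<ominus> x)) \<longlonglongrightarrow> 0)"
proof -
  have "(range s \<subseteq> S \<inter> carrier A \<and> limitin metr.mtopology s x sequentially) \<longleftrightarrow>
      (x \<in> carrier A \<and> (\<forall>n. s n \<in> S \<inter> carrier A) \<and> (\<lambda>n. nrm A (s n \<ominus> x)) \<longlonglongrightarrow> 0)" for s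
    using limitin_norm[of s x] by (auto simp: image_subset_iff)
  then show ?thesis
    unfolding metr.closure_of_sequentially by auto
qed

lemma tendsto_norm_add:
  assumes "\<And>n. s n \<in> carrier A" "\<And>n. t n \<in> carrier A" "x \<in> carrier A" "y \<in> carrier A"
    and "(\<lambda>n. nrm A (s n \<ominus> x)) \<longlonglongrightarrow> 0" "(\<lambda>n. nrm A (t n \<ominus> y)) \<longlonglongrightarrow> 0"
  shows "(\<lambda>n. nrm A ((s n \<oplus> t n) \<ominus> (x \<oplus> y))) \<longlonglongrightarrow> 0"
proof (rule Lim_null_comparison[OF always_eventually])
  show "(\<lambda>n. nrm A (s n \<ominus> x) + nrm A (t n \<ominus> y)) \<longlonglongrightarrow> 0"
    using tendsto_add[OF assms(5,6)] by simp
  show "\<forall>n. norm (nrm A ((s n \<oplus> t n) \<ominus> (x \<oplus> y))) \<le> nrm A (s n \<ominus> x) + nrm A (t n \<ominus> y)"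
  proof
    fix n
    note [simp] = assms(1-4)
    have "(s n \<oplus> t n) \<ominus> (x \<oplus> y) = (s n \<ominus> x) \<oplus> (t n \<ominus> y)"
      using assms(1)[of n] assms(2)[of n] assms(3,4) by algebra
    then show "norm (nrm A ((s n \<oplus> t n) \<ominus> (x \<oplus> y))) \<le> nrm A (s n \<ominus> x) + nrm A (t n \<ominus> y)"
      using nrm_triangle[of "s n \<ominus> x" "t n \<ominus> y"] by simp
  qed
qed

lemma tendsto_norm_mult:
  assumes "\<And>n. s n \<in> carrier A" "\<And>n. t n \<in> carrier A" "x \<in> carrier A" "y \<in> carrier A"
    and "(\<lambda>n. nrm A (s n \<ominus> x)) \<longlonglongrightarrow> 0" "(\<lambda>n. nrm A (t n \<ominus> y)) \<longlonglongrightarrow> 0"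
  shows "(\<lambda>n. nrm A ((s n \<otimes> t n) \<ominus> (x \<otimes> y))) \<longlonglongrightarrow> 0"
proof (rule Lim_null_comparison[OF always_eventually])
  let ?u = "\<lambda>n. nrm A (s n \<ominus> x)" and ?v = "\<lambda>n. nrm A (t n \<ominus> y)"
  show "(\<lambda>n. ?u n * (?v n + nrm A y) + nrm A x * ?v n) \<longlonglongrightarrow> 0"
    by (rule tendsto_eq_intros assms refl | simp)+
  show "\<forall>n. norm (nrm A ((s n \<otimes> t n) \<ominus> (x \<otimes> y))) \<le> ?u n * (?v n + nrm A y) + nrm A x * ?v n"
  proof
    fix n
    note [simp] = assms(1-4)
    have "(s n \<otimes> t n) \<ominus> (x \<otimes> y) = (s n \<ominus> x) \<otimes> t n \<oplus> x \<otimes> (t n \<ominus> y)"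
      using assms(1)[of n] assms(2)[of n] assms(3,4) by algebra
    then have "nrm A ((s n \<otimes> t n) \<ominus> (x \<otimes> y)) \<le> nrm A ((s n \<ominus> x) \<otimes> t n) + nrm A (x \<otimes> (t n \<ominus> y))"
      by (simp add: nrm_triangle)
    also have "\<dots> \<le> ?u n * nrm A (t n) + nrm A x * ?v n"
      by (intro add_mono nrm_mult) auto
    also have "\<dots> \<le> ?u n * (?v n + nrm A y) + nrm A x * ?v n"
      by (intro add_mono mult_left_mono nrm_minus_le) auto
    finally show "norm (nrm A ((s n \<otimes> t n) \<ominus> (x \<otimes> y))) \<le> ?u n * (?v n + nrm A y) + nrm A x * ?v n"
      by simp
  qed
qed

end

lemma (in star_subalgebra) star_subalgebra_closure:
  "star_subalgebra A (metr.mtopology closure_of S)"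
proof (intro star_subalgebra.intro star_subalgebra_axioms.intro normed_star_algebra_axioms)
  let ?S = "metr.mtopology closure_of S"
  show "?S \<subseteq> carrier A"
    using in_closure_of_sequence by blast
  have mem [simp]: "x \<in> carrier A" if "x \<in> S" for x
    using that subset by blast
  show "\<one> \<in> ?S"
    using one_mem by (auto simp: in_closure_of_sequence intro!: exI[of _ "\<lambda>n. \<one>"])
  show "c \<odot> x \<in> ?S" if x: "x \<in> ?S" for c x
  proof -
    obtain s where s: "x \<in> carrier A" "\<And>n. s n \<in> S" "(\<lambda>n. nrm A (s n \<ominus> x)) \<longlonglongrightarrow> 0"
      using x by (auto simp: in_closure_of_sequence)
    have "nrm A (c \<odot> s n \<ominus> c \<odot> x) = cmod c * nrm A (s n \<ominus> x)" for n
      using s by (simp add: smult_minus [symmetric] nrm_smult)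
    then have "(\<lambda>n. nrm A (c \<odot> s n \<ominus> c \<odot> x)) \<longlonglongrightarrow> 0"
      using tendsto_mult_left[OF s(3), of "cmod c"] by simp
    with s show ?thesis
      by (auto simp: in_closure_of_sequence smult_mem intro!: exI[of _ "\<lambda>n. c \<odot> s n"])
  qed
  show "adj A x \<in> ?S" if x: "x \<in> ?S" for x
  proof -
    obtain s where s: "x \<in> carrier A" "\<And>n. s n \<in> S" "(\<lambda>n. nrm A (s n \<ominus> x)) \<longlonglongrightarrow> 0"
      using x by (auto simp: in_closure_of_sequence)
    have "nrm A (adj A (s n) \<ominus> adj A x) = nrm A (s n \<ominus> x)" for n
      using s by (simp add: adj_minus [symmetric] nrm_adj)
    with s show ?thesis
      by (auto simp: in_closure_of_sequence adj_mem adj_closed intro!: exI[of _ "\<lambda>n. adj A (s n)"])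
  qed
  fix x y assume xy: "x \<in> ?S" "y \<in> ?S"
  obtain s where s: "x \<in> carrier A" "\<And>n. s n \<in> S" "(\<lambda>n. nrm A (s n \<ominus> x)) \<longlonglongrightarrow> 0"
    using xy(1) by (auto simp: in_closure_of_sequence)
  obtain t where t: "y \<in> carrier A" "\<And>n. t n \<in> S" "(\<lambda>n. nrm A (t n \<ominus> y)) \<longlonglongrightarrow> 0"
    using xy(2) by (auto simp: in_closure_of_sequence)
  show "x \<oplus> y \<in> ?S"
    using s t tendsto_norm_add[of s t x y]
    by (auto simp: in_closure_of_sequence add_mem intro!: exI[of _ "\<lambda>n. s n \<oplus> t n"])
  show "x \<otimes> y \<in> ?S"
    using s t tendsto_norm_mult[of s t x y]
    by (auto simp: in_closure_of_sequence mult_mem intro!: exI[of _ "\<lambda>n. s n \<otimes> t n"])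
qed

section \<open>Bounded products\<close>

lemma (in normed_star_algebra) smult_minus_one_add:
  "x \<in> carrier A \<Longrightarrow> (- 1) \<odot> x \<oplus> x = \<zero>"
  by (simp add: smult_minus_one l_neg)

text \<open>
  Collected under names of this locale, the algebraic identities can be instantiated at all algebras of
  a family at once, which reduces the axioms of the product to those of the factors.
\<close>

lemmas (in normed_star_algebra) a_commute = a_comm

lemmas (in normed_star_algebra) star_algebra_simps =
  smult_minus_one_add l_zero l_one r_one smult_one a_assoc m_assoc l_distr r_distr smult_l_distr
  smult_r_distr smult_assoc smult_mult_left smult_mult_right adj_adj adj_add adj_smult adj_mult
  a_closed m_closed smult_closed adj_closed zero_closed one_closed

text \<open>
  The operations are kept folded and only evaluated at an index: the membership facts for the bounded
  product are about the folded forms.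
\<close>

lemma cstar_prod_apply [simp]:
  assumes "a \<in> D"
  shows "mult (cstar_prod D C) F G a = F a \<otimes>\<^bsub>C a\<^esub> G a"
    and "one (cstar_prod D C) a = \<one>\<^bsub>C a\<^esub>"
    and "zero (cstar_prod D C) a = \<zero>\<^bsub>C a\<^esub>"
    and "add (cstar_prod D C) F G a = F a \<oplus>\<^bsub>C a\<^esub> G a"
    and "smult (cstar_prod D C) c F a = c \<odot>\<^bsub>C a\<^esub> F a"
    and "adj (cstar_prod D C) F a = adj (C a) (F a)"
  using assms by (simp_all add: cstar_prod_def)

lemma cstar_prod_extensional [simp]:
  "mult (cstar_prod D C) F G \<in> extensional D"
  "add (cstar_prod D C) F G \<in> extensional D"
  "smult (cstar_prod D C) c F \<in> extensional D"
  "adj (cstar_prod D C) F \<in> extensional D"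
  "one (cstar_prod D C) \<in> extensional D"
  "zero (cstar_prod D C) \<in> extensional D"
  by (simp_all only: cstar_prod_def cstar.simps module.simps ring.simps monoid.simps partial_object.simps
      restrict_extensional)

lemma nrm_cstar_prod: "nrm (cstar_prod D C) F = (SUP a\<in>D. nrm (C a) (F a))"
  by (simp add: cstar_prod_def)

lemma carrier_cstar_prodI:
  assumes "F \<in> extensional D" "\<And>a. a \<in> D \<Longrightarrow> F a \<in> carrier (C a)"
    and "\<And>a. a \<in> D \<Longrightarrow> nrm (C a) (F a) \<le> M"
  shows "F \<in> carrier (cstar_prod D C)"
  using assms by (auto simp: cstar_prod_def PiE_def intro!: bdd_aboveI2)

lemma carrier_cstar_prodD:
  assumes "F \<in> carrier (cstar_prod D C)"
  shows "F \<in> extensional D" and "a \<in> D \<Longrightarrow> F a \<in> carrier (C a)"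
    and "bdd_above ((\<lambda>a. nrm (C a) (F a)) ` D)"
  using assms by (auto simp: cstar_prod_def PiE_def)

lemma nrm_le_cstar_prod:
  assumes "F \<in> carrier (cstar_prod D C)" "a \<in> D"
  shows "nrm (C a) (F a) \<le> nrm (cstar_prod D C) F"
  unfolding nrm_cstar_prod using assms by (intro cSUP_upper carrier_cstar_prodD(3))

lemma nrm_cstar_prod_le:
  assumes "D \<noteq> {}" "\<And>a. a \<in> D \<Longrightarrow> nrm (C a) (F a) \<le> M"
  shows "nrm (cstar_prod D C) F \<le> M"
  unfolding nrm_cstar_prod using assms by (intro cSUP_least)

locale star_algebra_family =
  fixes D :: "'i set" and C :: "'i \<Rightarrow> 'x cstar"
  assumes nonempty: "D \<noteq> {}"
    and normed: "\<And>a. a \<in> D \<Longrightarrow> normed_star_algebra (C a)"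
begin

abbreviation "P \<equiv> cstar_prod D C"

lemma mult_closed_cstar_prod:
  assumes F: "F \<in> carrier P" and G: "G \<in> carrier P"
  shows "F \<otimes>\<^bsub>P\<^esub> G \<in> carrier P" "nrm P (F \<otimes>\<^bsub>P\<^esub> G) \<le> nrm P F * nrm P G"
proof -
  have le: "nrm (C a) ((F \<otimes>\<^bsub>P\<^esub> G) a) \<le> nrm P F * nrm P G" if a: "a \<in> D" for a
  proof -
    interpret normed_star_algebra "C a"
      using a by (rule normed)
    note FG = carrier_cstar_prodD(2)[OF F a] carrier_cstar_prodD(2)[OF G a]
    have "nrm (C a) (F a \<otimes>\<^bsub>C a\<^esub> G a) \<le> nrm (C a) (F a) * nrm (C a) (G a)"
      using FG by (rule nrm_mult)
    also have "\<dots> \<le> nrm P F * nrm P G"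
      using FG order_trans[OF nrm_nonneg[OF FG(1)] nrm_le_cstar_prod[OF F a]]
      by (intro mult_mono nrm_le_cstar_prod F G a nrm_nonneg) auto
    finally show ?thesis using a by simp
  qed
  show "F \<otimes>\<^bsub>P\<^esub> G \<in> carrier P"
  proof (rule carrier_cstar_prodI[OF _ _ le])
    fix a assume a: "a \<in> D"
    then interpret normed_star_algebra "C a"
      by (rule normed)
    show "(F \<otimes>\<^bsub>P\<^esub> G) a \<in> carrier (C a)"
      using a F G by (auto dest: carrier_cstar_prodD(2))
  qed (rule cstar_prod_extensional)
  show "nrm P (F \<otimes>\<^bsub>P\<^esub> G) \<le> nrm P F * nrm P G"
    by (rule nrm_cstar_prod_le[OF nonempty le])
qed

lemma add_closed_cstar_prod:
  assumes F: "F \<in> carrier P" and G: "G \<in> carrier P"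
  shows "F \<oplus>\<^bsub>P\<^esub> G \<in> carrier P" "nrm P (F \<oplus>\<^bsub>P\<^esub> G) \<le> nrm P F + nrm P G"
proof -
  have le: "nrm (C a) ((F \<oplus>\<^bsub>P\<^esub> G) a) \<le> nrm P F + nrm P G" if a: "a \<in> D" for a
  proof -
    interpret normed_star_algebra "C a"
      using a by (rule normed)
    have "nrm (C a) (F a \<oplus>\<^bsub>C a\<^esub> G a) \<le> nrm (C a) (F a) + nrm (C a) (G a)"
      using carrier_cstar_prodD(2)[OF F a] carrier_cstar_prodD(2)[OF G a] by (rule nrm_triangle)
    also have "\<dots> \<le> nrm P F + nrm P G"
      by (intro add_mono nrm_le_cstar_prod F G a)
    finally show ?thesis using a by simp
  qed
  show "F \<oplus>\<^bsub>P\<^esub> G \<in> carrier P"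
  proof (rule carrier_cstar_prodI[OF _ _ le])
    fix a assume a: "a \<in> D"
    then interpret normed_star_algebra "C a"
      by (rule normed)
    show "(F \<oplus>\<^bsub>P\<^esub> G) a \<in> carrier (C a)"
      using a F G by (auto dest: carrier_cstar_prodD(2))
  qed (rule cstar_prod_extensional)
  show "nrm P (F \<oplus>\<^bsub>P\<^esub> G) \<le> nrm P F + nrm P G"
    by (rule nrm_cstar_prod_le[OF nonempty le])
qed

lemma smult_closed_cstar_prod:
  assumes F: "F \<in> carrier P"
  shows "c \<odot>\<^bsub>P\<^esub> F \<in> carrier P" "nrm P (c \<odot>\<^bsub>P\<^esub> F) \<le> cmod c * nrm P F"
proof -
  have le: "nrm (C a) ((c \<odot>\<^bsub>P\<^esub> F) a) \<le> cmod c * nrm P F" if a: "a \<in> D" for a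
    using a carrier_cstar_prodD(2)[OF F a] nrm_le_cstar_prod[OF F a]
    by (simp add: normed_star_algebra.nrm_smult[OF normed] mult_left_mono)
  show "c \<odot>\<^bsub>P\<^esub> F \<in> carrier P"
    using carrier_cstar_prodD(2)[OF F] normed_star_algebra.smult_closed[OF normed]
    by (intro carrier_cstar_prodI[OF cstar_prod_extensional(3) _ le]) auto
  show "nrm P (c \<odot>\<^bsub>P\<^esub> F) \<le> cmod c * nrm P F"
    by (rule nrm_cstar_prod_le[OF nonempty le])
qed

lemma adj_closed_cstar_prod:
  assumes F: "F \<in> carrier P"
  shows "adj P F \<in> carrier P" "nrm P (adj P F) = nrm P F"
proof -
  have eq: "nrm (C a) (adj P F a) = nrm (C a) (F a)" if a: "a \<in> D" for a
    using a carrier_cstar_prodD(2)[OF F a] by (simp add: normed_star_algebra.nrm_adj[OF normed])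
  show "adj P F \<in> carrier P"
    using carrier_cstar_prodD(2)[OF F] normed_star_algebra.adj_closed[OF normed] eq
      nrm_le_cstar_prod[OF F]
    by (intro carrier_cstar_prodI[OF cstar_prod_extensional(4), where M = "nrm P F"]) auto
  show "nrm P (adj P F) = nrm P F"
    using eq by (simp add: nrm_cstar_prod cong: SUP_cong)
qed

lemma zero_one_closed_cstar_prod: "\<zero>\<^bsub>P\<^esub> \<in> carrier P" "\<one>\<^bsub>P\<^esub> \<in> carrier P"
proof -
  have zero: "\<zero>\<^bsub>C a\<^esub> \<in> carrier (C a)" "nrm (C a) \<zero>\<^bsub>C a\<^esub> \<le> 1"
    and one: "\<one>\<^bsub>C a\<^esub> \<in> carrier (C a)" "nrm (C a) \<one>\<^bsub>C a\<^esub> \<le> 1" if a: "a \<in> D" for a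
  proof -
    interpret normed_star_algebra "C a"
      using a by (rule normed)
    show "\<zero>\<^bsub>C a\<^esub> \<in> carrier (C a)" "nrm (C a) \<zero>\<^bsub>C a\<^esub> \<le> 1"
      "\<one>\<^bsub>C a\<^esub> \<in> carrier (C a)" "nrm (C a) \<one>\<^bsub>C a\<^esub> \<le> 1"
      using nrm_one_le by auto
  qed
  show "\<zero>\<^bsub>P\<^esub> \<in> carrier P" "\<one>\<^bsub>P\<^esub> \<in> carrier P"
    using zero one by (auto intro!: carrier_cstar_prodI[where M = 1])
qed

lemma cstar_prod_closed [simp, intro]:
  "\<zero>\<^bsub>P\<^esub> \<in> carrier P" "\<one>\<^bsub>P\<^esub> \<in> carrier P"
  "F \<in> carrier P \<Longrightarrow> G \<in> carrier P \<Longrightarrow> F \<oplus>\<^bsub>P\<^esub> G \<in> carrier P"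
  "F \<in> carrier P \<Longrightarrow> G \<in> carrier P \<Longrightarrow> F \<otimes>\<^bsub>P\<^esub> G \<in> carrier P"
  "F \<in> carrier P \<Longrightarrow> c \<odot>\<^bsub>P\<^esub> F \<in> carrier P"
  "F \<in> carrier P \<Longrightarrow> adj P F \<in> carrier P"
  by (rule zero_one_closed_cstar_prod add_closed_cstar_prod mult_closed_cstar_prod
      smult_closed_cstar_prod adj_closed_cstar_prod; assumption)+

lemma cstar_prod_eqI:
  assumes "F \<in> carrier P" "G \<in> carrier P" "\<And>a. a \<in> D \<Longrightarrow> F a = G a"
  shows "F = G"
  using assms by (meson carrier_cstar_prodD(1) extensionalityI)

lemmas factor_simps = normed_star_algebra.star_algebra_simps[OF normed]

lemma normed_star_algebra_cstar_prod: "normed_star_algebra P"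
proof -
  have pt: "F a \<in> carrier (C a)" if "F \<in> carrier P" "a \<in> D" for F a
    using that by (rule carrier_cstar_prodD(2))
  have group: "abelian_group P"
  proof (rule abelian_groupI)
    fix F assume F: "F \<in> carrier P"
    have "(- 1) \<odot>\<^bsub>P\<^esub> F \<oplus>\<^bsub>P\<^esub> F = \<zero>\<^bsub>P\<^esub>"
      by (rule cstar_prod_eqI) (use F in \<open>auto simp: pt factor_simps\<close>)
    with F show "\<exists>G\<in>carrier P. G \<oplus>\<^bsub>P\<^esub> F = \<zero>\<^bsub>P\<^esub>"
      by blast
    show "\<zero>\<^bsub>P\<^esub> \<oplus>\<^bsub>P\<^esub> F = F"
      by (rule cstar_prod_eqI) (use F in \<open>auto simp: pt factor_simps\<close>)
  next
    fix F G H assume FGH: "F \<in> carrier P" "G \<in> carrier P" "H \<in> carrier P"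
    show "F \<oplus>\<^bsub>P\<^esub> G \<oplus>\<^bsub>P\<^esub> H = F \<oplus>\<^bsub>P\<^esub> (G \<oplus>\<^bsub>P\<^esub> H)"
      by (rule cstar_prod_eqI) (use FGH in \<open>auto simp: pt factor_simps\<close>)
  next
    fix F G assume FG: "F \<in> carrier P" "G \<in> carrier P"
    then show "F \<oplus>\<^bsub>P\<^esub> G = G \<oplus>\<^bsub>P\<^esub> F"
      by (intro cstar_prod_eqI) (auto simp: pt normed_star_algebra.a_commute[OF normed])
  qed auto
  have ring: "ring P"
  proof (intro ringI group monoidI)
    fix F assume F: "F \<in> carrier P"
    show "\<one>\<^bsub>P\<^esub> \<otimes>\<^bsub>P\<^esub> F = F"
      by (rule cstar_prod_eqI) (use F in \<open>auto simp: pt factor_simps\<close>)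
    show "F \<otimes>\<^bsub>P\<^esub> \<one>\<^bsub>P\<^esub> = F"
      by (rule cstar_prod_eqI) (use F in \<open>auto simp: pt factor_simps\<close>)
  next
    fix F G H assume FGH: "F \<in> carrier P" "G \<in> carrier P" "H \<in> carrier P"
    show "F \<otimes>\<^bsub>P\<^esub> G \<otimes>\<^bsub>P\<^esub> H = F \<otimes>\<^bsub>P\<^esub> (G \<otimes>\<^bsub>P\<^esub> H)"
      by (rule cstar_prod_eqI) (use FGH in \<open>auto simp: pt factor_simps\<close>)
    show "(F \<oplus>\<^bsub>P\<^esub> G) \<otimes>\<^bsub>P\<^esub> H = F \<otimes>\<^bsub>P\<^esub> H \<oplus>\<^bsub>P\<^esub> G \<otimes>\<^bsub>P\<^esub> H"
      by (rule cstar_prod_eqI) (use FGH in \<open>auto simp: pt factor_simps\<close>)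
    show "H \<otimes>\<^bsub>P\<^esub> (F \<oplus>\<^bsub>P\<^esub> G) = H \<otimes>\<^bsub>P\<^esub> F \<oplus>\<^bsub>P\<^esub> H \<otimes>\<^bsub>P\<^esub> G"
      by (rule cstar_prod_eqI) (use FGH in \<open>auto simp: pt factor_simps\<close>)
  qed auto
  have module: "module complex_ring P"
  proof (intro moduleI cring_complex_ring group)
    fix c d F G assume FG: "F \<in> carrier P" "G \<in> carrier P"
    show "c \<odot>\<^bsub>P\<^esub> (F \<oplus>\<^bsub>P\<^esub> G) = c \<odot>\<^bsub>P\<^esub> F \<oplus>\<^bsub>P\<^esub> c \<odot>\<^bsub>P\<^esub> G"
      by (rule cstar_prod_eqI) (use FG in \<open>auto simp: pt factor_simps\<close>)
  next
    fix c d F assume F: "F \<in> carrier P"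
    show "(c \<oplus>\<^bsub>complex_ring\<^esub> d) \<odot>\<^bsub>P\<^esub> F = c \<odot>\<^bsub>P\<^esub> F \<oplus>\<^bsub>P\<^esub> d \<odot>\<^bsub>P\<^esub> F"
      by (rule cstar_prod_eqI) (use F in \<open>auto simp: pt factor_simps\<close>)
    show "(c \<otimes>\<^bsub>complex_ring\<^esub> d) \<odot>\<^bsub>P\<^esub> F = c \<odot>\<^bsub>P\<^esub> (d \<odot>\<^bsub>P\<^esub> F)"
      by (rule cstar_prod_eqI) (use F in \<open>auto simp: pt factor_simps\<close>)
    show "\<one>\<^bsub>complex_ring\<^esub> \<odot>\<^bsub>P\<^esub> F = F"
      by (rule cstar_prod_eqI) (use F in \<open>auto simp: pt factor_simps\<close>)
  qed auto
  show ?thesis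
  proof (intro normed_star_algebra.intro ring module)
    fix F assume F: "F \<in> carrier P"
    show "nrm P F = 0 \<longleftrightarrow> F = \<zero>\<^bsub>P\<^esub>"
    proof
      assume zero: "nrm P F = 0"
      show "F = \<zero>\<^bsub>P\<^esub>"
      proof (rule cstar_prod_eqI)
        fix a assume a: "a \<in> D"
        then interpret normed_star_algebra "C a"
          by (rule normed)
        have "nrm (C a) (F a) = 0"
          using nrm_le_cstar_prod[OF F a] zero nrm_nonneg[OF pt[OF F a]] by simp
        then show "F a = \<zero>\<^bsub>P\<^esub> a"
          using a pt[OF F a] by (simp add: nrm_eq_0_iff)
      qed (use F in blast)+
    next
      assume "F = \<zero>\<^bsub>P\<^esub>"
      then have "nrm (C a) (F a) = 0" if "a \<in> D" for a
        using that by (simp add: normed_star_algebra.nrm_zero[OF normed])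
      then show "nrm P F = 0"
        using nonempty by (simp add: nrm_cstar_prod)
    qed
    show "nrm P (c \<odot>\<^bsub>P\<^esub> F) = cmod c * nrm P F" for c
    proof (cases "c = 0")
      case True
      have "nrm (C a) ((c \<odot>\<^bsub>P\<^esub> F) a) = 0" if a: "a \<in> D" for a
        using a pt[OF F a] True by (simp add: normed_star_algebra.nrm_smult[OF normed])
      then show ?thesis
        using nonempty True by (simp add: nrm_cstar_prod)
    next
      case False
      have "F = (inverse c) \<odot>\<^bsub>P\<^esub> (c \<odot>\<^bsub>P\<^esub> F)"
        by (rule cstar_prod_eqI)
          (use F False in \<open>auto simp: pt factor_simps simp flip: normed_star_algebra.smult_assoc[OF normed]\<close>)
      then have "nrm P F \<le> cmod (inverse c) * nrm P (c \<odot>\<^bsub>P\<^esub> F)"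
        using smult_closed_cstar_prod(2)[of "c \<odot>\<^bsub>P\<^esub> F" "inverse c"] F by simp
      then have "cmod c * nrm P F \<le> nrm P (c \<odot>\<^bsub>P\<^esub> F)"
        using False by (simp add: norm_inverse norm_divide field_simps)
      then show ?thesis
        using smult_closed_cstar_prod(2)[OF F, of c] by simp
    qed
    show "nrm P (adj P F) = nrm P F"
      using F by (rule adj_closed_cstar_prod)
    fix G assume G: "G \<in> carrier P"
    show "nrm P (F \<oplus>\<^bsub>P\<^esub> G) \<le> nrm P F + nrm P G"
      using F G by (rule add_closed_cstar_prod)
    show "nrm P (F \<otimes>\<^bsub>P\<^esub> G) \<le> nrm P F * nrm P G"
      using F G by (rule mult_closed_cstar_prod)
    fix c
    show "(c \<odot>\<^bsub>P\<^esub> F) \<otimes>\<^bsub>P\<^esub> G = c \<odot>\<^bsub>P\<^esub> (F \<otimes>\<^bsub>P\<^esub> G)"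
      by (rule cstar_prod_eqI) (use F G in \<open>auto simp: pt factor_simps\<close>)
    show "F \<otimes>\<^bsub>P\<^esub> (c \<odot>\<^bsub>P\<^esub> G) = c \<odot>\<^bsub>P\<^esub> (F \<otimes>\<^bsub>P\<^esub> G)"
      by (rule cstar_prod_eqI) (use F G in \<open>auto simp: pt factor_simps\<close>)
    show "adj P (F \<oplus>\<^bsub>P\<^esub> G) = adj P F \<oplus>\<^bsub>P\<^esub> adj P G"
      by (rule cstar_prod_eqI) (use F G in \<open>auto simp: pt factor_simps\<close>)
    show "adj P (F \<otimes>\<^bsub>P\<^esub> G) = adj P G \<otimes>\<^bsub>P\<^esub> adj P F"
      by (rule cstar_prod_eqI) (use F G in \<open>auto simp: pt factor_simps\<close>)
    show "adj P (c \<odot>\<^bsub>P\<^esub> F) = cnj c \<odot>\<^bsub>P\<^esub> adj P F"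
      by (rule cstar_prod_eqI) (use F in \<open>auto simp: pt factor_simps\<close>)
    show "adj P (adj P F) = F"
      by (rule cstar_prod_eqI) (use F in \<open>auto simp: pt factor_simps\<close>)
    show "adj P F \<in> carrier P"
      using F by simp
  next
    show "nrm P \<one>\<^bsub>P\<^esub> \<le> 1"
      by (rule nrm_cstar_prod_le[OF nonempty]) (simp add: normed_star_algebra.nrm_one_le[OF normed])
  qed
qed

end

sublocale star_algebra_family \<subseteq> prod: normed_star_algebra P
  by (rule normed_star_algebra_cstar_prod)

context star_algebra_family
begin

lemma minus_cstar_prod:
  assumes "F \<in> carrier P" "G \<in> carrier P" "a \<in> D"
  shows "(F \<ominus>\<^bsub>P\<^esub> G) a = F a \<ominus>\<^bsub>C a\<^esub> G a"
proof -
  interpret normed_star_algebra "C a"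
    using assms(3) by (rule normed)
  have "F \<ominus>\<^bsub>P\<^esub> G = F \<oplus>\<^bsub>P\<^esub> (- 1) \<odot>\<^bsub>P\<^esub> G"
    using assms prod.smult_minus_one[of G] by (simp add: a_minus_def)
  then show ?thesis
    using assms smult_minus_one[OF carrier_cstar_prodD(2)[OF assms(2,3)]] by (simp add: a_minus_def)
qed

text \<open>
  A Cauchy sequence of families converges at each index, and letting the second member of the sequence
  tend to infinity in the Cauchy estimate bounds the distance to the pointwise limit uniformly in the index.
\<close>

lemma banach_star_algebra_cstar_prod:
  assumes banach: "\<And>a. a \<in> D \<Longrightarrow> banach_star_algebra (C a)"
  shows "banach_star_algebra P"
proof -
  have "prod.metr.mcomplete"
    unfolding prod.metr.mcomplete_def
  proof (intro allI impI)
    fix F assume cau: "prod.metr.MCauchy F"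
    then have F: "F n \<in> carrier P" for n
      by (simp add: prod.metr.MCauchy_def image_subset_iff)
    have close: "\<exists>N. \<forall>m n. N \<le> m \<longrightarrow> N \<le> n \<longrightarrow> nrm P (F m \<ominus>\<^bsub>P\<^esub> F n) < \<epsilon>" if "\<epsilon> > 0" for \<epsilon>
      using cau that F by (simp add: prod.metr.MCauchy_def prod.norm_dist_eq)
    have pt: "F n a \<in> carrier (C a)" if "a \<in> D" for n a
      using carrier_cstar_prodD(2)[OF F that] .
    have pt_le: "nrm (C a) (F m a \<ominus>\<^bsub>C a\<^esub> F n a) \<le> nrm P (F m \<ominus>\<^bsub>P\<^esub> F n)" if "a \<in> D" for a m n
      using nrm_le_cstar_prod[OF prod.minus_closed[OF F F] that] by (simp add: minus_cstar_prod F that)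
    have "\<exists>l. l \<in> carrier (C a) \<and> (\<lambda>n. nrm (C a) (F n a \<ominus>\<^bsub>C a\<^esub> l)) \<longlonglongrightarrow> 0" if a: "a \<in> D" for a
    proof -
      interpret banach_star_algebra "C a"
        using a by (rule banach)
      have "metr.MCauchy (\<lambda>n. F n a)"
        unfolding metr.MCauchy_def
      proof (intro conjI allI impI)
        fix \<epsilon> :: real assume "\<epsilon> > 0"
        then obtain N where N: "\<And>m n. N \<le> m \<Longrightarrow> N \<le> n \<Longrightarrow> nrm P (F m \<ominus>\<^bsub>P\<^esub> F n) < \<epsilon>"
          using close[of \<epsilon>] by blast
        have "norm_dist (C a) (F m a) (F n a) < \<epsilon>" if "N \<le> m" "N \<le> n" for m n
          using N[OF that] pt_le[OF a, of m n] pt[OF a] by (simp add: norm_dist_eq)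
        then show "\<exists>N. \<forall>m n. N \<le> m \<longrightarrow> N \<le> n \<longrightarrow> norm_dist (C a) (F m a) (F n a) < \<epsilon>"
          by blast
      qed (use pt[OF a] in auto)
      then obtain l where "limitin metr.mtopology (\<lambda>n. F n a) l sequentially"
        using complete unfolding metr.mcomplete_def by blast
      then show ?thesis
        using limitin_norm[of "\<lambda>n. F n a" l] pt[OF a] by auto
    qed
    then obtain g where g: "\<And>a. a \<in> D \<Longrightarrow> g a \<in> carrier (C a)"
        "\<And>a. a \<in> D \<Longrightarrow> (\<lambda>n. nrm (C a) (F n a \<ominus>\<^bsub>C a\<^esub> g a)) \<longlonglongrightarrow> 0"
      by metis
    define G where "G = restrict g D"
    \<comment> \<open>The Cauchy estimate survives the passage to the limit at each index.\<close>
    have pt_lim: "nrm (C a) (F n a \<ominus>\<^bsub>C a\<^esub> g a) \<le> \<epsilon>"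
      if a: "a \<in> D" and le: "\<And>m. M \<le> m \<Longrightarrow> nrm P (F n \<ominus>\<^bsub>P\<^esub> F m) \<le> \<epsilon>" for a n M \<epsilon>
    proof -
      interpret banach_star_algebra "C a"
        using a by (rule banach)
      have "(\<lambda>m. \<epsilon> + nrm (C a) (F m a \<ominus>\<^bsub>C a\<^esub> g a)) \<longlonglongrightarrow> \<epsilon> + 0"
        by (intro tendsto_add tendsto_const g a)
      then have lim: "(\<lambda>m. \<epsilon> + nrm (C a) (F m a \<ominus>\<^bsub>C a\<^esub> g a)) \<longlonglongrightarrow> \<epsilon>"
        by simp
      have "nrm (C a) (F n a \<ominus>\<^bsub>C a\<^esub> g a) \<le> \<epsilon> + nrm (C a) (F m a \<ominus>\<^bsub>C a\<^esub> g a)" if "M \<le> m" for m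
        using nrm_triangle_minus[OF pt[OF a] pt[OF a] g(1)[OF a], of n m] le[OF that] pt_le[OF a, of n m]
        by linarith
      then show ?thesis
        by (intro LIMSEQ_le_const[OF lim]) blast
    qed
    obtain N where N: "\<And>m. N \<le> m \<Longrightarrow> nrm P (F N \<ominus>\<^bsub>P\<^esub> F m) \<le> 1"
      using close[of 1] by (meson less_imp_le order_refl zero_less_one)
    have G: "G \<in> carrier P"
    proof (rule carrier_cstar_prodI)
      show "nrm (C a) (G a) \<le> 1 + nrm P (F N)" if a: "a \<in> D" for a
      proof -
        interpret banach_star_algebra "C a"
          using a by (rule banach)
        have "nrm (C a) (g a) \<le> nrm (C a) (g a \<ominus>\<^bsub>C a\<^esub> F N a) + nrm (C a) (F N a)"
          by (intro nrm_minus_le g pt a)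
        then show ?thesis
          using pt_lim[of a N N 1, OF a N] nrm_le_cstar_prod[OF F a, of N] nrm_minus_commute[OF g(1)[OF a] pt[OF a], of N] a
          by (simp add: G_def)
      qed
    qed (auto simp: G_def g)
    have "(\<lambda>n. nrm P (F n \<ominus>\<^bsub>P\<^esub> G)) \<longlonglongrightarrow> 0"
    proof (rule LIMSEQ_I)
      fix \<epsilon> :: real assume "\<epsilon> > 0"
      then obtain M where M: "\<And>m n. M \<le> m \<Longrightarrow> M \<le> n \<Longrightarrow> nrm P (F m \<ominus>\<^bsub>P\<^esub> F n) < \<epsilon> / 2"
        using close[of "\<epsilon> / 2"] by auto
      have "nrm P (F n \<ominus>\<^bsub>P\<^esub> G) \<le> \<epsilon> / 2" if n: "M \<le> n" for n
      proof (rule nrm_cstar_prod_le[OF nonempty])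
        fix a assume a: "a \<in> D"
        show "nrm (C a) ((F n \<ominus>\<^bsub>P\<^esub> G) a) \<le> \<epsilon> / 2"
          using pt_lim[of a M n "\<epsilon> / 2"] M[OF n] a
          by (simp add: minus_cstar_prod F G less_imp_le) (simp add: G_def)
      qed
      then have "norm (nrm P (F n \<ominus>\<^bsub>P\<^esub> G) - 0) < \<epsilon>" if "M \<le> n" for n
        using \<open>\<epsilon> > 0\<close> prod.nrm_nonneg[OF prod.minus_closed[OF F G]] that by force
      then show "\<exists>M. \<forall>n\<ge>M. norm (nrm P (F n \<ominus>\<^bsub>P\<^esub> G) - 0) < \<epsilon>"
        by blast
    qed
    then have "limitin prod.metr.mtopology F G sequentially"
      using prod.limitin_norm[of F G] F G by auto
    then show "\<exists>l. limitin prod.metr.mtopology F l sequentially"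
      by blast
  qed
  then show ?thesis
    by (intro banach_star_algebra.intro banach_star_algebra_axioms.intro prod.normed_star_algebra_axioms)
qed

end

section \<open>Quotients by closed *-ideals\<close>

text \<open>
  Topological closedness is stated by approximation, the form in which it shows that a coset with
  representatives of arbitrarily small norm is zero.
\<close>

locale closed_star_ideal = normed_star_algebra +
  fixes J
  assumes ideal: "ideal J A"
    and smult_mem: "x \<in> J \<Longrightarrow> c \<odot> x \<in> J"
    and adj_mem: "x \<in> J \<Longrightarrow> adj A x \<in> J"
    and closed: "\<lbrakk>x \<in> carrier A; \<And>\<epsilon>. \<epsilon> > 0 \<Longrightarrow> \<exists>y\<in>J. nrm A (x \<ominus> y) < \<epsilon>\<rbrakk> \<Longrightarrow> x \<in> J"

sublocale closed_star_ideal \<subseteq> ideal J A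
  by (rule ideal)

context closed_star_ideal
begin

abbreviation "Q \<equiv> cstar_quot A J"

lemma coset_eq_iff:
  assumes "x \<in> carrier A" "y \<in> carrier A"
  shows "J +> x = J +> y \<longleftrightarrow> x \<ominus> y \<in> J"
  using a_rcos_module_minus[OF ring assms(2,1)] a_repr_independence'[of x y]
    a_repr_independenceD[of x y] assms by auto

lemma carrier_quot: "carrier Q = (+>) J ` carrier A"
  by (auto simp: cstar_quot_def FactRing_def A_RCOSETS_def')

lemma coset_closed [simp]: "x \<in> carrier A \<Longrightarrow> J +> x \<in> carrier Q"
  by (simp add: carrier_quot)

lemma quotE:
  assumes "X \<in> carrier Q"
  obtains x where "x \<in> carrier A" "X = J +> x"
  using assms by (auto simp: carrier_quot)

lemma quot_ring_ops [simp]: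
  assumes "x \<in> carrier A" "y \<in> carrier A"
  shows "(J +> x) \<otimes>\<^bsub>Q\<^esub> (J +> y) = J +> (x \<otimes> y)"
    and "(J +> x) \<oplus>\<^bsub>Q\<^esub> (J +> y) = J +> (x \<oplus> y)"
  using assms by (simp_all add: cstar_quot_def FactRing_def rcoset_mult_add a_rcos_sum)

lemma quot_one: "\<one>\<^bsub>Q\<^esub> = J +> \<one>"
  by (simp add: cstar_quot_def FactRing_def)

lemma quot_zero: "\<zero>\<^bsub>Q\<^esub> = J +> \<zero>"
  using a_rcos_const[OF additive_subgroup.zero_closed[OF is_additive_subgroup]]
  by (simp add: cstar_quot_def FactRing_def)

lemma coset_memD:
  assumes "x \<in> carrier A" "y \<in> J +> x"
  shows "y \<in> carrier A" "J +> y = J +> x"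
  using assms a_elemrcos_carrier a_repr_independence' by auto

lemma quot_smult [simp]:
  assumes x: "x \<in> carrier A"
  shows "c \<odot>\<^bsub>Q\<^esub> (J +> x) = J +> (c \<odot> x)"
proof -
  have eq: "J +> (c \<odot> y) = J +> (c \<odot> x)" if "y \<in> J +> x" for y
    using coset_memD[OF x that] coset_eq_iff[of y x] coset_eq_iff[of "c \<odot> y" "c \<odot> x"] x
      smult_mem[of "y \<ominus> x" c] by (simp add: smult_minus)
  have "(\<Union>y\<in>J +> x. J +> (c \<odot> y)) = J +> (c \<odot> x)"
    using eq a_rcos_self[OF x] by blast
  then show ?thesis
    by (simp add: cstar_quot_def)
qed

lemma quot_adj [simp]:
  assumes x: "x \<in> carrier A"
  shows "adj Q (J +> x) = J +> adj A x"
proof -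
  have eq: "J +> adj A y = J +> adj A x" if "y \<in> J +> x" for y
    using coset_memD[OF x that] coset_eq_iff[of y x] coset_eq_iff[of "adj A y" "adj A x"] x
      adj_mem[of "y \<ominus> x"] by (simp add: adj_minus adj_closed)
  have "(\<Union>y\<in>J +> x. J +> adj A y) = J +> adj A x"
    using eq a_rcos_self[OF x] by blast
  then show ?thesis
    by (simp add: cstar_quot_def)
qed

lemma nrm_quot: "nrm Q X = (INF x\<in>X. nrm A x)"
  by (simp add: cstar_quot_def)

lemma bdd_below_coset: "x \<in> carrier A \<Longrightarrow> bdd_below (nrm A ` (J +> x))"
  by (rule bdd_belowI[of _ 0]) (auto dest: coset_memD)

lemma nrm_quot_le: "x \<in> carrier A \<Longrightarrow> nrm Q (J +> x) \<le> nrm A x"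
  unfolding nrm_quot by (intro cINF_lower bdd_below_coset a_rcos_self)

lemma nrm_quot_greatest:
  assumes x: "x \<in> carrier A" and le: "\<And>y. \<lbrakk>y \<in> carrier A; x \<ominus> y \<in> J\<rbrakk> \<Longrightarrow> M \<le> nrm A y"
  shows "M \<le> nrm Q (J +> x)"
  unfolding nrm_quot
proof (rule cINF_greatest)
  fix y assume y: "y \<in> J +> x"
  show "M \<le> nrm A y"
    using coset_memD[OF x y] coset_eq_iff[of x y] le x by simp
qed (use a_rcos_self[OF x] in blast)

text \<open>
  All upper estimates of the quotient norm come from representatives whose norm is close to the infimum.
\<close>

lemma nrm_quot_representative:
  assumes "X \<in> carrier Q" "nrm Q X < u"
  obtains x where "x \<in> carrier A" "X = J +> x" "nrm A x < u"
proof -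
  obtain x where x: "x \<in> carrier A" "X = J +> x"
    using assms(1) by (rule quotE)
  have "X \<noteq> {}"
    using a_rcos_self[OF x(1)] x(2) by blast
  then obtain y where y: "y \<in> X" "nrm A y < u"
    using assms(2) x bdd_below_coset[OF x(1)] unfolding nrm_quot by (auto simp: cINF_less_iff)
  then show thesis
    using that coset_memD[OF x(1), of y] x(2) by metis
qed

lemma nrm_quot_nonneg:
  assumes "X \<in> carrier Q"
  shows "0 \<le> nrm Q X"
proof -
  obtain x where "x \<in> carrier A" "X = J +> x"
    using assms by (rule quotE)
  then show ?thesis
    by (auto intro: nrm_quot_greatest)
qed

lemma nrm_quot_smult_le:
  assumes X: "X \<in> carrier Q"
  shows "nrm Q (c \<odot>\<^bsub>Q\<^esub> X) \<le> cmod c * nrm Q X"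
proof (rule field_le_epsilon)
  fix \<epsilon> :: real assume \<epsilon>: "\<epsilon> > 0"
  define \<delta> where "\<delta> = \<epsilon> / (cmod c + 1)"
  have c: "cmod c + 1 > 0"
    by (simp add: add_nonneg_pos)
  have \<delta>: "\<delta> > 0" "cmod c * \<delta> \<le> \<epsilon>"
    using \<epsilon> c by (simp_all add: \<delta>_def field_simps)
  obtain x where x: "x \<in> carrier A" "X = J +> x" "nrm A x < nrm Q X + \<delta>"
    using nrm_quot_representative[OF X, of "nrm Q X + \<delta>"] \<delta> by auto
  have "nrm Q (c \<odot>\<^bsub>Q\<^esub> X) \<le> nrm A (c \<odot> x)"
    using nrm_quot_le[of "c \<odot> x"] x by simp
  also have "\<dots> = cmod c * nrm A x"
    by (rule nrm_smult[OF x(1)])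
  also have "\<dots> \<le> cmod c * (nrm Q X + \<delta>)"
    using x(3) by (intro mult_left_mono) auto
  also have "\<dots> \<le> cmod c * nrm Q X + \<epsilon>"
    using \<delta> by (simp add: algebra_simps)
  finally show "nrm Q (c \<odot>\<^bsub>Q\<^esub> X) \<le> cmod c * nrm Q X + \<epsilon>" .
qed

lemma nrm_quot_adj_le:
  assumes X: "X \<in> carrier Q"
  shows "nrm Q (adj Q X) \<le> nrm Q X"
proof (rule field_le_epsilon)
  fix \<epsilon> :: real assume \<epsilon>: "\<epsilon> > 0"
  obtain x where x: "x \<in> carrier A" "X = J +> x" "nrm A x < nrm Q X + \<epsilon>"
    using nrm_quot_representative[OF X, of "nrm Q X + \<epsilon>"] \<epsilon> by auto
  then show "nrm Q (adj Q X) \<le> nrm Q X + \<epsilon>"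
    using nrm_quot_le[of "adj A x"] by (simp add: adj_closed nrm_adj)
qed

lemma nrm_quot_triangle:
  assumes X: "X \<in> carrier Q" and Y: "Y \<in> carrier Q"
  shows "nrm Q (X \<oplus>\<^bsub>Q\<^esub> Y) \<le> nrm Q X + nrm Q Y"
proof (rule field_le_epsilon)
  fix \<epsilon> :: real assume \<epsilon>: "\<epsilon> > 0"
  obtain x where x: "x \<in> carrier A" "X = J +> x" "nrm A x < nrm Q X + \<epsilon> / 2"
    using nrm_quot_representative[OF X, of "nrm Q X + \<epsilon> / 2"] \<epsilon> by auto
  obtain y where y: "y \<in> carrier A" "Y = J +> y" "nrm A y < nrm Q Y + \<epsilon> / 2"
    using nrm_quot_representative[OF Y, of "nrm Q Y + \<epsilon> / 2"] \<epsilon> by auto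
  show "nrm Q (X \<oplus>\<^bsub>Q\<^esub> Y) \<le> nrm Q X + nrm Q Y + \<epsilon>"
    using nrm_quot_le[of "x \<oplus> y"] nrm_triangle[of x y] x y by simp
qed

lemma nrm_quot_mult:
  assumes X: "X \<in> carrier Q" and Y: "Y \<in> carrier Q"
  shows "nrm Q (X \<otimes>\<^bsub>Q\<^esub> Y) \<le> nrm Q X * nrm Q Y"
proof (rule tendsto_lowerbound)
  \<comment> \<open>Submultiplicativity holds up to \<open>\<epsilon>\<close> on representatives; the right-hand side is continuous in \<open>\<epsilon>\<close>.\<close>
  show "((\<lambda>\<epsilon>. (nrm Q X + \<epsilon>) * (nrm Q Y + \<epsilon>)) \<longlongrightarrow> nrm Q X * nrm Q Y) (at_right 0)"
    by (rule tendsto_eq_intros refl | simp)+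
  show "\<forall>\<^sub>F \<epsilon> in at_right 0. nrm Q (X \<otimes>\<^bsub>Q\<^esub> Y) \<le> (nrm Q X + \<epsilon>) * (nrm Q Y + \<epsilon>)"
    using eventually_at_right_less
  proof eventually_elim
    fix \<epsilon> :: real assume \<epsilon>: "\<epsilon> > 0"
    obtain x where x: "x \<in> carrier A" "X = J +> x" "nrm A x < nrm Q X + \<epsilon>"
      using nrm_quot_representative[OF X, of "nrm Q X + \<epsilon>"] \<epsilon> by auto
    obtain y where y: "y \<in> carrier A" "Y = J +> y" "nrm A y < nrm Q Y + \<epsilon>"
      using nrm_quot_representative[OF Y, of "nrm Q Y + \<epsilon>"] \<epsilon> by auto
    have "nrm Q (X \<otimes>\<^bsub>Q\<^esub> Y) \<le> nrm A x * nrm A y"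
      using nrm_quot_le[of "x \<otimes> y"] nrm_mult[of x y] x y by simp
    also have "\<dots> \<le> (nrm Q X + \<epsilon>) * (nrm Q Y + \<epsilon>)"
      using x y nrm_quot_nonneg[OF X] \<epsilon> by (intro mult_mono) auto
    finally show "nrm Q (X \<otimes>\<^bsub>Q\<^esub> Y) \<le> (nrm Q X + \<epsilon>) * (nrm Q Y + \<epsilon>)" .
  qed
qed simp

lemma nrm_quot_eq_0_iff:
  assumes X: "X \<in> carrier Q"
  shows "nrm Q X = 0 \<longleftrightarrow> X = \<zero>\<^bsub>Q\<^esub>"
proof
  assume zero: "nrm Q X = 0"
  obtain x where x: "x \<in> carrier A" "X = J +> x"
    using X by (rule quotE)
  have "x \<in> J"
  proof (rule closed[OF x(1)])
    fix \<epsilon> :: real assume "\<epsilon> > 0"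
    then obtain y where y: "y \<in> carrier A" "X = J +> y" "nrm A y < \<epsilon>"
      using nrm_quot_representative[OF X, of \<epsilon>] zero by auto
    have "x \<ominus> y \<in> J"
      using coset_eq_iff[of x y] x y by simp
    moreover have "x \<ominus> (x \<ominus> y) = y"
      using x(1) y(1) by algebra
    ultimately show "\<exists>z\<in>J. nrm A (x \<ominus> z) < \<epsilon>"
      using y(3) by (intro bexI[of _ "x \<ominus> y"]) auto
  qed
  moreover have "x \<ominus> \<zero> = x"
    using x(1) by algebra
  ultimately show "X = \<zero>\<^bsub>Q\<^esub>"
    using coset_eq_iff[of x \<zero>] x by (simp add: quot_zero)
next
  assume "X = \<zero>\<^bsub>Q\<^esub>"
  then show "nrm Q X = 0"
    using nrm_quot_le[of \<zero>] nrm_quot_nonneg[OF X] by (simp add: quot_zero)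
qed

lemma normed_star_algebra_quot: "normed_star_algebra Q"
proof -
  have group: "abelian_group Q"
  proof (rule abelian_groupI)
    fix X assume "X \<in> carrier Q"
    then obtain x where x: "x \<in> carrier A" "X = J +> x"
      by (rule quotE)
    then show "\<zero>\<^bsub>Q\<^esub> \<oplus>\<^bsub>Q\<^esub> X = X"
      by (simp add: quot_zero)
    show "\<exists>Y\<in>carrier Q. Y \<oplus>\<^bsub>Q\<^esub> X = \<zero>\<^bsub>Q\<^esub>"
      by (rule bexI[of _ "J +> \<ominus> x"]) (use x in \<open>simp_all add: quot_zero l_neg\<close>)
  next
    fix X Y assume "X \<in> carrier Q" "Y \<in> carrier Q"
    then show "X \<oplus>\<^bsub>Q\<^esub> Y = Y \<oplus>\<^bsub>Q\<^esub> X"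
      by (elim quotE) (simp add: a_comm)
  qed (auto elim!: quotE simp: quot_zero a_assoc)
  have ring: "ring Q"
    by (intro ringI group monoidI) (auto elim!: quotE simp: quot_one m_assoc l_distr r_distr)
  have module: "module complex_ring Q"
    by (intro moduleI cring_complex_ring group)
      (auto elim!: quotE simp: smult_l_distr smult_r_distr smult_assoc)
  show ?thesis
  proof (intro normed_star_algebra.intro ring module)
    fix X assume X: "X \<in> carrier Q"
    show "nrm Q X = 0 \<longleftrightarrow> X = \<zero>\<^bsub>Q\<^esub>"
      using X by (rule nrm_quot_eq_0_iff)
    have adj: "adj Q X \<in> carrier Q" "adj Q (adj Q X) = X"
      using X by (auto elim!: quotE simp: adj_closed adj_adj)
    then show "nrm Q (adj Q X) = nrm Q X"
      using nrm_quot_adj_le[OF X] nrm_quot_adj_le[OF adj(1)] by simp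
    show "nrm Q (c \<odot>\<^bsub>Q\<^esub> X) = cmod c * nrm Q X" for c
    proof (cases "c = 0")
      case True
      then show ?thesis
        using nrm_quot_smult_le[OF X, of c] nrm_quot_nonneg[of "c \<odot>\<^bsub>Q\<^esub> X"] X
        by (auto elim!: quotE)
    next
      case False
      have cX: "c \<odot>\<^bsub>Q\<^esub> X \<in> carrier Q" "inverse c \<odot>\<^bsub>Q\<^esub> (c \<odot>\<^bsub>Q\<^esub> X) = X"
        using X False by (auto elim!: quotE simp flip: smult_assoc)
      then have "nrm Q X \<le> cmod (inverse c) * nrm Q (c \<odot>\<^bsub>Q\<^esub> X)"
        using nrm_quot_smult_le[OF cX(1), of "inverse c"] by simp
      then have "cmod c * nrm Q X \<le> nrm Q (c \<odot>\<^bsub>Q\<^esub> X)"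
        using False by (simp add: norm_inverse norm_divide field_simps)
      then show ?thesis
        using nrm_quot_smult_le[OF X, of c] by simp
    qed
  next
    show "nrm Q \<one>\<^bsub>Q\<^esub> \<le> 1"
      using nrm_quot_le[of \<one>] nrm_one_le by (simp add: quot_one)
  qed (auto simp: nrm_quot_triangle nrm_quot_mult elim!: quotE
      simp: smult_mult_left smult_mult_right adj_closed adj_adj adj_add adj_smult adj_mult)
qed

end

sublocale closed_star_ideal \<subseteq> quot: normed_star_algebra Q
  by (rule normed_star_algebra_quot)

context closed_star_ideal
begin

lemma quot_minus [simp]:
  assumes "x \<in> carrier A" "y \<in> carrier A"
  shows "(J +> x) \<ominus>\<^bsub>Q\<^esub> (J +> y) = J +> (x \<ominus> y)"
proof -
  have "\<ominus>\<^bsub>Q\<^esub> (J +> y) = J +> (\<ominus> y)"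
    using quot.smult_minus_one[of "J +> y"] assms by (simp add: smult_minus_one)
  then show ?thesis
    using assms by (simp add: a_minus_def)
qed

text \<open>
  The differences of consecutive terms of a sequence in the quotient are lifted to representatives
  \<open>y n\<close> below the geometric bound; their partial sums, started at a representative of the first term, represent the given
  sequence and form a Cauchy sequence in the algebra.
\<close>

lemma banach_star_algebra_quot:
  assumes complete: "metr.mcomplete"
  shows "banach_star_algebra Q"
proof -
  have "quot.metr.mcomplete"
  proof (rule quot.mcompleteI_geometric)
    fix X assume X: "\<And>n. X n \<in> carrier Q"
      and step: "\<And>n. nrm Q (X (Suc n) \<ominus>\<^bsub>Q\<^esub> X n) < (1/2) ^ n"
    have "\<exists>y. y \<in> carrier A \<and> J +> y = X (Suc n) \<ominus>\<^bsub>Q\<^esub> X n \<and> nrm A y < (1/2) ^ n" for n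
      using nrm_quot_representative[OF quot.minus_closed[OF X X] step, of n] by metis
    then obtain y where y: "\<And>n. y n \<in> carrier A" "\<And>n. J +> y n = X (Suc n) \<ominus>\<^bsub>Q\<^esub> X n"
        "\<And>n. nrm A (y n) < (1/2) ^ n"
      by metis
    obtain x0 where x0: "x0 \<in> carrier A" "X 0 = J +> x0"
      using X by (rule quotE)
    define x where "x = rec_nat x0 (\<lambda>n z. z \<oplus> y n)"
    have x_Suc: "x (Suc n) = x n \<oplus> y n" for n
      by (simp add: x_def)
    have x: "x n \<in> carrier A" for n
      by (induction n) (simp_all add: x_def x0 y)
    have x_coset: "X n = J +> x n" for n
    proof (induction n)
      case 0
      then show ?case by (simp add: x_def x0)
    next
      case (Suc n)
      have "X (Suc n) = X n \<oplus>\<^bsub>Q\<^esub> (X (Suc n) \<ominus>\<^bsub>Q\<^esub> X n)"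
        using X[of n] X[of "Suc n"] quot.ring_axioms by algebra
      also have "\<dots> = (J +> x n) \<oplus>\<^bsub>Q\<^esub> (J +> y n)"
        unfolding y(2) Suc ..
      finally show ?case
        using x y(1) by (simp add: x_Suc)
    qed
    have "x (Suc n) \<ominus> x n = y n" for n
    proof -
      have "(x n \<oplus> y n) \<ominus> x n = y n"
        using x[of n] y(1)[of n] by algebra
      then show ?thesis by (simp add: x_Suc)
    qed
    then have "metr.MCauchy x"
      using x y(3) by (intro MCauchy_geometric) (auto simp: less_imp_le)
    then obtain l where "limitin metr.mtopology x l sequentially"
      using complete unfolding metr.mcomplete_def by blast
    then have l: "l \<in> carrier A" "(\<lambda>n. nrm A (x n \<ominus> l)) \<longlonglongrightarrow> 0"
      using limitin_norm[of x l] x by auto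
    have "(\<lambda>n. nrm Q (X n \<ominus>\<^bsub>Q\<^esub> (J +> l))) \<longlonglongrightarrow> 0"
    proof (rule Lim_null_comparison[OF always_eventually l(2)], rule allI)
      show "norm (nrm Q (X n \<ominus>\<^bsub>Q\<^esub> (J +> l))) \<le> nrm A (x n \<ominus> l)" for n
        using nrm_quot_le[of "x n \<ominus> l"] nrm_quot_nonneg[of "J +> (x n \<ominus> l)"] x l(1)
        by (simp add: x_coset)
    qed
    then have "limitin quot.metr.mtopology X (J +> l) sequentially"
      using quot.limitin_norm[of X "J +> l"] X l(1) by auto
    then show "\<exists>l. limitin quot.metr.mtopology X l sequentially" ..
  qed
  then show ?thesis
    by (intro banach_star_algebra.intro banach_star_algebra_axioms.intro quot.normed_star_algebra_axioms)
qed

end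

section \<open>Homomorphisms\<close>

lemma star_homI:
  assumes "\<And>x. x \<in> carrier A \<Longrightarrow> h x \<in> carrier B"
    and "\<And>x y. \<lbrakk>x \<in> carrier A; y \<in> carrier A\<rbrakk> \<Longrightarrow> h (x \<otimes>\<^bsub>A\<^esub> y) = h x \<otimes>\<^bsub>B\<^esub> h y"
    and "\<And>x y. \<lbrakk>x \<in> carrier A; y \<in> carrier A\<rbrakk> \<Longrightarrow> h (x \<oplus>\<^bsub>A\<^esub> y) = h x \<oplus>\<^bsub>B\<^esub> h y"
    and "h \<one>\<^bsub>A\<^esub> = \<one>\<^bsub>B\<^esub>"
    and "\<And>c x. x \<in> carrier A \<Longrightarrow> h (c \<odot>\<^bsub>A\<^esub> x) = c \<odot>\<^bsub>B\<^esub> h x"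
    and "\<And>x. x \<in> carrier A \<Longrightarrow> h (adj A x) = adj B (h x)"
  shows "h \<in> star_hom A B"
  using assms by (auto simp: star_hom_def intro!: ring_hom_memI)

lemma star_homD:
  assumes "h \<in> star_hom A B"
  shows "x \<in> carrier A \<Longrightarrow> h x \<in> carrier B"
    and "\<lbrakk>x \<in> carrier A; y \<in> carrier A\<rbrakk> \<Longrightarrow> h (x \<otimes>\<^bsub>A\<^esub> y) = h x \<otimes>\<^bsub>B\<^esub> h y"
    and "\<lbrakk>x \<in> carrier A; y \<in> carrier A\<rbrakk> \<Longrightarrow> h (x \<oplus>\<^bsub>A\<^esub> y) = h x \<oplus>\<^bsub>B\<^esub> h y"
    and "h \<one>\<^bsub>A\<^esub> = \<one>\<^bsub>B\<^esub>"
    and "x \<in> carrier A \<Longrightarrow> h (c \<odot>\<^bsub>A\<^esub> x) = c \<odot>\<^bsub>B\<^esub> h x"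
    and "x \<in> carrier A \<Longrightarrow> h (adj A x) = adj B (h x)"
  using assms by (auto simp: star_hom_def ring_hom_def)

lemma star_hom_minus:
  assumes "h \<in> star_hom A B" "normed_star_algebra A" "normed_star_algebra B"
    and "x \<in> carrier A" "y \<in> carrier A"
  shows "h (x \<ominus>\<^bsub>A\<^esub> y) = h x \<ominus>\<^bsub>B\<^esub> h y"
proof -
  interpret A: normed_star_algebra A by fact
  interpret B: normed_star_algebra B by fact
  have "h (x \<oplus>\<^bsub>A\<^esub> (- 1) \<odot>\<^bsub>A\<^esub> y) = h x \<oplus>\<^bsub>B\<^esub> (- 1) \<odot>\<^bsub>B\<^esub> h y"
    using assms by (simp add: star_homD[OF assms(1)])
  then show ?thesis
    using assms by (simp add: a_minus_def A.smult_minus_one B.smult_minus_one star_homD[OF assms(1)])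
qed

lemma star_subalgebra_image:
  assumes h: "h \<in> star_hom A B" and B: "normed_star_algebra B" and S: "star_subalgebra A S"
  shows "star_subalgebra B (h ` S)"
proof -
  interpret S: star_subalgebra A S by (rule S)
  have mem: "x \<in> carrier A" if "x \<in> S" for x
    using that S.subset by blast
  show ?thesis
  proof (intro star_subalgebra.intro star_subalgebra_axioms.intro B)
    show "h ` S \<subseteq> carrier B"
      using star_homD(1)[OF h] mem by blast
    show "\<one>\<^bsub>B\<^esub> \<in> h ` S"
      using S.one_mem star_homD(4)[OF h] by (metis imageI)
    show "X \<oplus>\<^bsub>B\<^esub> Y \<in> h ` S" if "X \<in> h ` S" "Y \<in> h ` S" for X Y
      using that by (auto simp: mem S.add_mem simp flip: star_homD(3)[OF h])
    show "X \<otimes>\<^bsub>B\<^esub> Y \<in> h ` S" if "X \<in> h ` S" "Y \<in> h ` S" for X Y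
      using that by (auto simp: mem S.mult_mem simp flip: star_homD(2)[OF h])
    show "c \<odot>\<^bsub>B\<^esub> X \<in> h ` S" if "X \<in> h ` S" for c X
      using that by (auto simp: mem S.smult_mem simp flip: star_homD(5)[OF h])
    show "adj B X \<in> h ` S" if "X \<in> h ` S" for X
      using that by (auto simp: mem S.adj_mem simp flip: star_homD(6)[OF h])
  qed
qed

text \<open>
  The inverse of an injective *-homomorphism on its range is again a *-homomorphism. The orientation
  from the range back to the domain is the one needed for a limit that is recognised as a range.
\<close>

lemma star_isomorphic_image:
  assumes h: "h \<in> star_hom A B" and A: "normed_star_algebra A" and inj: "inj_on h (carrier A)"
  shows "star_isomorphic (B\<lparr>carrier := h ` carrier A\<rparr>) A"
proof -
  interpret A: normed_star_algebra A by (rule A)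
  let ?g = "inv_into (carrier A) h"
  have gh: "?g (h x) = x" if "x \<in> carrier A" for x
    using inj that by (rule inv_into_f_f)
  have "?g \<in> star_hom (B\<lparr>carrier := h ` carrier A\<rparr>) A"
    by (rule star_homI) (auto simp: gh A.adj_closed simp flip: star_homD(2-6)[OF h])
  moreover have "bij_betw ?g (h ` carrier A) (carrier A)"
    using inj by (intro bij_betw_inv_into inj_on_imp_bij_betw)
  ultimately show ?thesis
    unfolding star_isomorphic_def by (intro bexI[of _ ?g]) auto
qed

lemma star_isomorphic_trans:
  assumes "star_isomorphic A B" "star_isomorphic B C"
  shows "star_isomorphic A C"
proof -
  obtain f g where f: "f \<in> star_hom A B" "bij_betw f (carrier A) (carrier B)"
    and g: "g \<in> star_hom B C" "bij_betw g (carrier B) (carrier C)"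
    using assms by (auto simp: star_isomorphic_def)
  have "g \<circ> f \<in> star_hom A C"
    by (rule star_homI) (simp_all add: star_homD[OF f(1)] star_homD[OF g(1)])
  with bij_betw_trans[OF f(2) g(2)] show ?thesis
    unfolding star_isomorphic_def by blast
qed

text \<open>
  A convergent sequence in the range is Cauchy, hence comes from a Cauchy sequence in the domain,
  whose limit is mapped to the limit of the given sequence.
\<close>

lemma isometric_image_closed:
  assumes h: "h \<in> star_hom A B" and A: "banach_star_algebra A" and B: "normed_star_algebra B"
    and isometric: "\<And>x. x \<in> carrier A \<Longrightarrow> nrm B (h x) = nrm A x"
  shows "Metric_space.mtopology (carrier B) (norm_dist B) closure_of (h ` carrier A) = h ` carrier A"
proof -
  interpret A: banach_star_algebra A by (rule A)
  interpret B: normed_star_algebra B by (rule B)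
  have dist: "nrm B (h x \<ominus>\<^bsub>B\<^esub> h y) = nrm A (x \<ominus>\<^bsub>A\<^esub> y)" if "x \<in> carrier A" "y \<in> carrier A" for x y
    using isometric[of "x \<ominus>\<^bsub>A\<^esub> y"] that
      star_hom_minus[OF h A.normed_star_algebra_axioms B that] by simp
  have "y \<in> h ` carrier A" if y: "y \<in> B.metr.mtopology closure_of (h ` carrier A)" for y
  proof -
    obtain s where s: "y \<in> carrier B" "\<And>n. s n \<in> h ` carrier A" "(\<lambda>n. nrm B (s n \<ominus>\<^bsub>B\<^esub> y)) \<longlonglongrightarrow> 0"
      using y unfolding B.in_closure_of_sequence by blast
    have "\<forall>n. \<exists>x. x \<in> carrier A \<and> s n = h x"
      using s(2) by auto
    then obtain t where t: "\<And>n. t n \<in> carrier A" "\<And>n. s n = h (t n)"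
      by metis
    have ht: "h (t n) \<in> carrier B" for n
      using t(1) by (rule star_homD(1)[OF h])
    have lim_y: "limitin B.metr.mtopology (\<lambda>n. h (t n)) y sequentially"
      using B.limitin_norm[of "\<lambda>n. h (t n)" y] ht s t(2) by simp
    then have cau: "B.metr.MCauchy (\<lambda>n. h (t n))"
      using ht by (intro B.metr.convergent_imp_MCauchy) auto
    have "norm_dist A (t m) (t n) = norm_dist B (h (t m)) (h (t n))" for m n
      using dist t(1) ht by (simp add: A.norm_dist_eq B.norm_dist_eq)
    then have "A.metr.MCauchy t"
      using cau t(1) unfolding A.metr.MCauchy_def B.metr.MCauchy_def by auto
    then obtain l where "limitin A.metr.mtopology t l sequentially"
      using A.complete unfolding A.metr.mcomplete_def by blast
    then have l: "l \<in> carrier A" "(\<lambda>n. nrm A (t n \<ominus>\<^bsub>A\<^esub> l)) \<longlonglongrightarrow> 0"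
      using A.limitin_norm[of t l] t(1) by auto
    have "limitin B.metr.mtopology (\<lambda>n. h (t n)) (h l) sequentially"
      using B.limitin_norm[of "\<lambda>n. h (t n)" "h l"] ht l dist t(1) star_homD(1)[OF h l(1)] by simp
    then have "y = h l"
      using lim_y by (intro B.metr.limitin_metric_unique) auto
    then show ?thesis
      using l(1) by blast
  qed
  moreover have "h ` carrier A \<subseteq> B.metr.mtopology closure_of (h ` carrier A)"
    using star_homD(1)[OF h] by (intro closure_of_subset) auto
  ultimately show ?thesis
    by blast
qed

lemma restrict_star_hom:
  assumes "D' \<subseteq> D"
  shows "(\<lambda>F. restrict F D') \<in> star_hom (cstar_prod D C) (cstar_prod D' C)"
proof (rule star_homI)
  fix F assume F: "F \<in> carrier (cstar_prod D C)"
  then obtain M where M: "\<And>a. a \<in> D \<Longrightarrow> nrm (C a) (F a) \<le> M"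
    using carrier_cstar_prodD(3)[OF F] by (auto simp: bdd_above_def)
  show "restrict F D' \<in> carrier (cstar_prod D' C)"
    by (rule carrier_cstar_prodI[where M = M])
      (use assms M carrier_cstar_prodD(2)[OF F] in auto)
qed (use assms in \<open>auto simp: fun_eq_iff cstar_prod_def restrict_def subset_iff\<close>)

section \<open>Inductive limits\<close>

text \<open>
  The algebras are Banach *-algebras so that both systems are instances: the given one and the derived
  one, whose algebras are bounded products of inductive limits.
\<close>

locale star_system =
  fixes D :: "'k::order set" and C :: "'k \<Rightarrow> 'x cstar" and \<rho> :: "'k \<Rightarrow> 'k \<Rightarrow> 'x \<Rightarrow> 'x"
  assumes directed: "upward_directed D"
    and banach: "a \<in> D \<Longrightarrow> banach_star_algebra (C a)"
    and hom: "\<lbrakk>a \<in> D; b \<in> D; a \<le> b\<rbrakk> \<Longrightarrow> \<rho> b a \<in> star_hom (C a) (C b)"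
    and comp: "\<lbrakk>a \<in> D; b \<in> D; c \<in> D; a \<le> b; b \<le> c; x \<in> carrier (C a)\<rbrakk>
      \<Longrightarrow> \<rho> c a x = \<rho> c b (\<rho> b a x)"

sublocale star_system \<subseteq> star_algebra_family D C
  using directed banach
  by (intro star_algebra_family.intro) (auto simp: upward_directed_def dest: banach_star_algebra.axioms(1))

context star_system
begin

lemma upper_bound:
  assumes "a \<in> D" "b \<in> D"
  obtains c where "c \<in> D" "a \<le> c" "b \<le> c"
  using directed assms unfolding upward_directed_def by blast

abbreviation "N \<equiv> null_families D C"

lemma nullD:
  assumes "F \<in> N"
  shows "F \<in> carrier P"
    and "\<epsilon> > 0 \<Longrightarrow> \<exists>a\<in>D. \<forall>b\<in>D. a \<le> b \<longrightarrow> nrm (C b) (F b) < \<epsilon>"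
proof -
  show "F \<in> carrier P"
    using assms by (simp add: null_families_def)
  assume "\<epsilon> > 0"
  then obtain a where "a \<in> D" "\<And>b. \<lbrakk>b \<in> D; a \<le> b\<rbrakk> \<Longrightarrow> \<bar>nrm (C b) (F b)\<bar> < \<epsilon>"
    using assms unfolding null_families_def by blast
  then show "\<exists>a\<in>D. \<forall>b\<in>D. a \<le> b \<longrightarrow> nrm (C b) (F b) < \<epsilon>"
    by (meson abs_ge_self le_less_trans)
qed

lemma nullI:
  assumes "F \<in> carrier P" "\<And>\<epsilon>. \<epsilon> > 0 \<Longrightarrow> \<exists>a\<in>D. \<forall>b\<in>D. a \<le> b \<longrightarrow> nrm (C b) (F b) < \<epsilon>"
  shows "F \<in> N"
  using assms carrier_cstar_prodD(2)[OF assms(1)] normed_star_algebra.nrm_nonneg[OF normed]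
  unfolding null_families_def by simp

text \<open>
  Scalar multiples and adjoints of null families, and their products with bounded families, are
  pointwise dominated by multiples of null families.
\<close>

lemma null_dominated:
  assumes F: "F \<in> N" and G: "G \<in> carrier P" and "M \<ge> 0"
    and le: "\<And>b. b \<in> D \<Longrightarrow> nrm (C b) (G b) \<le> M * nrm (C b) (F b)"
  shows "G \<in> N"
proof (rule nullI[OF G])
  fix \<epsilon> :: real assume \<epsilon>: "\<epsilon> > 0"
  define \<delta> where "\<delta> = \<epsilon> / (M + 1)"
  have \<delta>: "\<delta> > 0" "M * \<delta> < \<epsilon>"
    using \<epsilon> \<open>M \<ge> 0\<close> by (simp_all add: \<delta>_def field_simps)
  obtain a where a: "a \<in> D" "\<And>b. \<lbrakk>b \<in> D; a \<le> b\<rbrakk> \<Longrightarrow> nrm (C b) (F b) < \<delta>"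
    using nullD(2)[OF F \<delta>(1)] by blast
  have "nrm (C b) (G b) < \<epsilon>" if "b \<in> D" "a \<le> b" for b
    using le[OF that(1)] mult_left_mono[OF less_imp_le[OF a(2)[OF that]] \<open>M \<ge> 0\<close>] \<delta>(2) by linarith
  with a(1) show "\<exists>a\<in>D. \<forall>b\<in>D. a \<le> b \<longrightarrow> nrm (C b) (G b) < \<epsilon>"
    by blast
qed

lemma null_add:
  assumes F: "F \<in> N" and G: "G \<in> N"
  shows "F \<oplus>\<^bsub>P\<^esub> G \<in> N"
proof (rule nullI)
  show "F \<oplus>\<^bsub>P\<^esub> G \<in> carrier P"
    using F G by (auto dest: nullD)
  fix \<epsilon> :: real assume "\<epsilon> > 0"
  then have \<epsilon>: "\<epsilon> / 2 > 0" by simp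
  obtain a where a: "a \<in> D" "\<And>d. \<lbrakk>d \<in> D; a \<le> d\<rbrakk> \<Longrightarrow> nrm (C d) (F d) < \<epsilon> / 2"
    using nullD(2)[OF F \<epsilon>] by blast
  obtain b where b: "b \<in> D" "\<And>d. \<lbrakk>d \<in> D; b \<le> d\<rbrakk> \<Longrightarrow> nrm (C d) (G d) < \<epsilon> / 2"
    using nullD(2)[OF G \<epsilon>] by blast
  obtain c where c: "c \<in> D" "a \<le> c" "b \<le> c"
    using a(1) b(1) by (rule upper_bound)
  have "nrm (C d) ((F \<oplus>\<^bsub>P\<^esub> G) d) < \<epsilon>" if d: "d \<in> D" "c \<le> d" for d
    using normed_star_algebra.nrm_triangle[OF normed[OF d(1)], of "F d" "G d"] a(2)[of d] b(2)[of d]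
      c d order_trans carrier_cstar_prodD(2)[OF nullD(1)] F G by fastforce
  with c(1) show "\<exists>a\<in>D. \<forall>b\<in>D. a \<le> b \<longrightarrow> nrm (C b) ((F \<oplus>\<^bsub>P\<^esub> G) b) < \<epsilon>"
    by blast
qed

lemma null_eventually_zero:
  assumes "F \<in> carrier P" "a \<in> D" "\<And>b. \<lbrakk>b \<in> D; a \<le> b\<rbrakk> \<Longrightarrow> F b = \<zero>\<^bsub>C b\<^esub>"
  shows "F \<in> N"
  using assms normed_star_algebra.nrm_zero[OF normed] by (intro nullI bexI[of _ a]) auto

lemma closed_star_ideal_null: "closed_star_ideal P N"
proof (intro closed_star_ideal.intro closed_star_ideal_axioms.intro prod.normed_star_algebra_axioms)
  obtain a where a: "a \<in> D"
    using nonempty by blast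
  have nonneg: "0 \<le> nrm (C b) (F b)" if "F \<in> carrier P" "b \<in> D" for F b
    using that carrier_cstar_prodD(2) normed_star_algebra.nrm_nonneg[OF normed] by metis
  have smult: "c \<odot>\<^bsub>P\<^esub> F \<in> N" if F: "F \<in> N" for c F
    by (rule null_dominated[OF F, where M = "cmod c"])
      (use carrier_cstar_prodD(2)[OF nullD(1)[OF F]] normed_star_algebra.nrm_smult[OF normed] nullD(1)[OF F] in auto)
  then show "c \<odot>\<^bsub>P\<^esub> F \<in> N" if "F \<in> N" for c F
    using that .
  show "adj P F \<in> N" if F: "F \<in> N" for F
    by (rule null_dominated[OF F, where M = 1])
      (use carrier_cstar_prodD(2)[OF nullD(1)[OF F]] normed_star_algebra.nrm_adj[OF normed] nullD(1)[OF F] in auto)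
  show "ideal N P"
  proof (rule idealI[OF prod.ring])
    show "subgroup N (add_monoid P)"
    proof (rule subgroup.intro)
      show "\<one>\<^bsub>add_monoid P\<^esub> \<in> N"
        using null_eventually_zero[of "\<zero>\<^bsub>P\<^esub>" a] a by simp
      fix F assume F: "F \<in> N"
      have "\<ominus>\<^bsub>P\<^esub> F \<in> N"
        using smult[OF F, of "- 1"] nullD(1)[OF F] by (simp add: prod.smult_minus_one)
      then show "inv\<^bsub>add_monoid P\<^esub> F \<in> N"
        by (simp add: a_inv_def)
    qed (auto dest: nullD simp: null_add)
    fix F G assume F: "F \<in> N" and G: "G \<in> carrier P"
    note FG = carrier_cstar_prodD(2)[OF nullD(1)[OF F]] carrier_cstar_prodD(2)[OF G]
    have G_le: "0 \<le> nrm P G"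
      using G by simp
    show "G \<otimes>\<^bsub>P\<^esub> F \<in> N"
    proof (rule null_dominated[OF F _ G_le])
      fix b assume b: "b \<in> D"
      have "nrm (C b) (G b \<otimes>\<^bsub>C b\<^esub> F b) \<le> nrm (C b) (G b) * nrm (C b) (F b)"
        using b FG by (intro normed_star_algebra.nrm_mult[OF normed]) auto
      also have "\<dots> \<le> nrm P G * nrm (C b) (F b)"
        using b by (intro mult_right_mono nrm_le_cstar_prod G nonneg nullD(1)[OF F])
      finally show "nrm (C b) ((G \<otimes>\<^bsub>P\<^esub> F) b) \<le> nrm P G * nrm (C b) (F b)"
        using b by simp
    qed (use G nullD(1)[OF F] in simp)
    show "F \<otimes>\<^bsub>P\<^esub> G \<in> N"
    proof (rule null_dominated[OF F _ G_le])
      fix b assume b: "b \<in> D"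
      have "nrm (C b) (F b \<otimes>\<^bsub>C b\<^esub> G b) \<le> nrm (C b) (F b) * nrm (C b) (G b)"
        using b FG by (intro normed_star_algebra.nrm_mult[OF normed]) auto
      also have "\<dots> \<le> nrm (C b) (F b) * nrm P G"
        using b by (intro mult_left_mono nrm_le_cstar_prod G nonneg nullD(1)[OF F])
      finally show "nrm (C b) ((F \<otimes>\<^bsub>P\<^esub> G) b) \<le> nrm P G * nrm (C b) (F b)"
        using b by (simp add: mult.commute)
    qed (use G nullD(1)[OF F] in simp)
  qed
  fix F assume F: "F \<in> carrier P" and approx: "\<And>\<epsilon>. \<epsilon> > 0 \<Longrightarrow> \<exists>G\<in>N. nrm P (F \<ominus>\<^bsub>P\<^esub> G) < \<epsilon>"
  show "F \<in> N"
  proof (rule nullI[OF F])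
    fix \<epsilon> :: real assume "\<epsilon> > 0"
    then have \<epsilon>: "\<epsilon> / 2 > 0" by simp
    obtain G where G: "G \<in> N" "nrm P (F \<ominus>\<^bsub>P\<^esub> G) < \<epsilon> / 2"
      using approx[OF \<epsilon>] by blast
    obtain a where a: "a \<in> D" "\<And>b. \<lbrakk>b \<in> D; a \<le> b\<rbrakk> \<Longrightarrow> nrm (C b) (G b) < \<epsilon> / 2"
      using nullD(2)[OF G(1) \<epsilon>] by blast
    have "nrm (C b) (F b) < \<epsilon>" if b: "b \<in> D" "a \<le> b" for b
      using normed_star_algebra.nrm_minus_le[OF normed[OF b(1)], of "F b" "G b"] a(2)[OF b] G
        nrm_le_cstar_prod[of "F \<ominus>\<^bsub>P\<^esub> G" D C b] b(1) F nullD(1)[OF G(1)]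
        carrier_cstar_prodD(2)[OF F b(1)] carrier_cstar_prodD(2)[OF nullD(1)[OF G(1)] b(1)]
      by (simp add: minus_cstar_prod)
    with a(1) show "\<exists>a\<in>D. \<forall>b\<in>D. a \<le> b \<longrightarrow> nrm (C b) (F b) < \<epsilon>"
      by blast
  qed
qed

end

sublocale star_system \<subseteq> null: closed_star_ideal P N
  by (rule closed_star_ideal_null)

context star_system
begin

abbreviation "Q \<equiv> cstar_quot P N"

lemma coset_star_hom: "a_r_coset P N \<in> star_hom P Q"
  by (rule star_homI) (simp_all add: null.quot_one)

text \<open>
  The quotient by the null families sees only the tails of a family. Identities such as
  multiplicativity of the canonical maps therefore have to be verified only above some index.
\<close>

lemma coset_eqI_eventually:
  assumes F: "F \<in> carrier P" and G: "G \<in> carrier P" and a: "a \<in> D"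
    and eq: "\<And>b. \<lbrakk>b \<in> D; a \<le> b\<rbrakk> \<Longrightarrow> F b = G b"
  shows "N +>\<^bsub>P\<^esub> F = N +>\<^bsub>P\<^esub> G"
proof -
  have "(F \<ominus>\<^bsub>P\<^esub> G) b = \<zero>\<^bsub>C b\<^esub>" if "b \<in> D" "a \<le> b" for b
    using minus_cstar_prod[OF F G that(1)] eq[OF that] carrier_cstar_prodD(2)[OF G that(1)]
      normed_star_algebra.minus_self[OF normed[OF that(1)]] by simp
  then have "F \<ominus>\<^bsub>P\<^esub> G \<in> N"
    using F G a by (intro null_eventually_zero) auto
  then show ?thesis
    using null.coset_eq_iff F G by blast
qed

text \<open>
  The bounded families that from some index on are given by the connecting maps. Their cosets are the
  elements of the union of the canonical images (\<open>limit_images\<close>), but unlike single images they can be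
  compared above a common index, so that they visibly form a *-subalgebra.
\<close>

definition coherent_families :: "('k \<Rightarrow> 'x) set" where
  "coherent_families =
    {F \<in> carrier P. \<exists>a\<in>D. \<exists>x\<in>carrier (C a). \<forall>b\<in>D. a \<le> b \<longrightarrow> F b = \<rho> b a x}"

text \<open>
  A family that follows the connecting maps from \<open>a\<close> on also does so from any later index, by
  the composition law. This is what allows two coherent families to be treated at a common index.
\<close>

lemma coherent_from:
  assumes "F \<in> coherent_families"
  obtains a where "a \<in> D"
    "\<forall>c\<in>D. a \<le> c \<longrightarrow> (\<exists>x\<in>carrier (C c). \<forall>b\<in>D. c \<le> b \<longrightarrow> F b = \<rho> b c x)"
proof -
  obtain a x where a: "a \<in> D" "x \<in> carrier (C a)" "\<And>b. \<lbrakk>b \<in> D; a \<le> b\<rbrakk> \<Longrightarrow> F b = \<rho> b a x"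
    using assms unfolding coherent_families_def by blast
  have "\<exists>y\<in>carrier (C c). \<forall>b\<in>D. c \<le> b \<longrightarrow> F b = \<rho> b c y" if c: "c \<in> D" "a \<le> c" for c
  proof (intro bexI ballI impI)
    show "\<rho> c a x \<in> carrier (C c)"
      using star_homD(1)[OF hom[OF a(1) c]] a(2) .
    show "F b = \<rho> b c (\<rho> c a x)" if "b \<in> D" "c \<le> b" for b
      using a(3)[of b] comp[OF a(1) c(1) that(1) c(2) that(2) a(2)] that c(2) order_trans by metis
  qed
  with a(1) show thesis
    using that by blast
qed

lemma star_subalgebra_coherent: "star_subalgebra P coherent_families"
proof (intro star_subalgebra.intro star_subalgebra_axioms.intro prod.normed_star_algebra_axioms)
  show "coherent_families \<subseteq> carrier P"
    by (auto simp: coherent_families_def)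
  obtain a where a: "a \<in> D"
    using nonempty by blast
  have "\<rho> b a \<one>\<^bsub>C a\<^esub> = \<one>\<^bsub>C b\<^esub>" if "b \<in> D" "a \<le> b" for b
    using star_homD(4)[OF hom[OF a that]] .
  moreover have "\<one>\<^bsub>C a\<^esub> \<in> carrier (C a)"
    using carrier_cstar_prodD(2)[OF cstar_prod_closed(2) a] a by simp
  ultimately show "\<one>\<^bsub>P\<^esub> \<in> coherent_families"
    using a by (auto simp: coherent_families_def intro!: bexI[of _ a] bexI[of _ "\<one>\<^bsub>C a\<^esub>"])
next
  fix F G assume F: "F \<in> coherent_families" and G: "G \<in> coherent_families"
  then have carr: "F \<in> carrier P" "G \<in> carrier P"
    by (auto simp: coherent_families_def)
  obtain a where a: "a \<in> D"
    "\<forall>c\<in>D. a \<le> c \<longrightarrow> (\<exists>x\<in>carrier (C c). \<forall>b\<in>D. c \<le> b \<longrightarrow> F b = \<rho> b c x)"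
    using F by (rule coherent_from)
  obtain a' where a': "a' \<in> D"
    "\<forall>c\<in>D. a' \<le> c \<longrightarrow> (\<exists>x\<in>carrier (C c). \<forall>b\<in>D. c \<le> b \<longrightarrow> G b = \<rho> b c x)"
    using G by (rule coherent_from)
  obtain c where c: "c \<in> D" "a \<le> c" "a' \<le> c"
    using a(1) a'(1) by (rule upper_bound)
  obtain x where x: "x \<in> carrier (C c)" "\<And>b. \<lbrakk>b \<in> D; c \<le> b\<rbrakk> \<Longrightarrow> F b = \<rho> b c x"
    using a(2) c(1,2) by blast
  obtain y where y: "y \<in> carrier (C c)" "\<And>b. \<lbrakk>b \<in> D; c \<le> b\<rbrakk> \<Longrightarrow> G b = \<rho> b c y"
    using a'(2) c(1,3) by blast
  interpret normed_star_algebra "C c"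
    using c(1) by (rule normed)
  have "\<forall>b\<in>D. c \<le> b \<longrightarrow> (F \<oplus>\<^bsub>P\<^esub> G) b = \<rho> b c (x \<oplus>\<^bsub>C c\<^esub> y)"
    using x y star_homD(3)[OF hom[OF c(1)]] by simp
  then show "F \<oplus>\<^bsub>P\<^esub> G \<in> coherent_families"
    using carr c(1) x(1) y(1) a_closed unfolding coherent_families_def by blast
  have "\<forall>b\<in>D. c \<le> b \<longrightarrow> (F \<otimes>\<^bsub>P\<^esub> G) b = \<rho> b c (x \<otimes>\<^bsub>C c\<^esub> y)"
    using x y star_homD(2)[OF hom[OF c(1)]] by simp
  then show "F \<otimes>\<^bsub>P\<^esub> G \<in> coherent_families"
    using carr c(1) x(1) y(1) m_closed unfolding coherent_families_def by blast
next
  fix k F assume F: "F \<in> coherent_families"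
  then obtain c x where carr: "F \<in> carrier P" and c: "c \<in> D"
    and x: "x \<in> carrier (C c)" "\<And>b. \<lbrakk>b \<in> D; c \<le> b\<rbrakk> \<Longrightarrow> F b = \<rho> b c x"
    unfolding coherent_families_def by blast
  interpret normed_star_algebra "C c"
    using c(1) by (rule normed)
  have "\<forall>b\<in>D. c \<le> b \<longrightarrow> (k \<odot>\<^bsub>P\<^esub> F) b = \<rho> b c (k \<odot>\<^bsub>C c\<^esub> x)"
    using x star_homD(5)[OF hom[OF c]] by simp
  then show "k \<odot>\<^bsub>P\<^esub> F \<in> coherent_families"
    using carr c x(1) smult_closed unfolding coherent_families_def by blast
  have "\<forall>b\<in>D. c \<le> b \<longrightarrow> adj P F b = \<rho> b c (adj (C c) x)"
    using x star_homD(6)[OF hom[OF c]] by simp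
  then show "adj P F \<in> coherent_families"
    using carr c x(1) adj_closed unfolding coherent_families_def by blast
qed

lemma theta_simps [simp]:
  "\<lbrakk>b \<in> D; a \<le> b\<rbrakk> \<Longrightarrow> theta D C \<rho> a x b = \<rho> b a x"
  "\<lbrakk>b \<in> D; \<not> a \<le> b\<rbrakk> \<Longrightarrow> theta D C \<rho> a x b = \<zero>\<^bsub>C b\<^esub>"
  "theta D C \<rho> a x \<in> extensional D"
  by (simp_all add: theta_def)

lemma theta_mem:
  assumes a: "a \<in> D" and x: "x \<in> carrier (C a)" and b: "b \<in> D"
  shows "theta D C \<rho> a x b \<in> carrier (C b)"
proof (cases "a \<le> b")
  case True
  then show ?thesis
    using star_homD(1)[OF hom[OF a b True] x] b by simp
next
  case False
  interpret normed_star_algebra "C b"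
    using b by (rule normed)
  show ?thesis
    using False b by simp
qed

lemma theta_closed:
  assumes a: "a \<in> D" and x: "x \<in> carrier (C a)" and "M \<ge> 0"
    and le: "\<And>b. \<lbrakk>b \<in> D; a \<le> b\<rbrakk> \<Longrightarrow> nrm (C b) (\<rho> b a x) \<le> M"
  shows "theta D C \<rho> a x \<in> carrier P" "nrm P (theta D C \<rho> a x) \<le> M"
proof -
  have "nrm (C b) (theta D C \<rho> a x b) \<le> M" if b: "b \<in> D" for b
    using b le[OF b] \<open>M \<ge> 0\<close> normed_star_algebra.nrm_zero[OF normed[OF b]] by (cases "a \<le> b") simp_all
  then show "theta D C \<rho> a x \<in> carrier P" "nrm P (theta D C \<rho> a x) \<le> M"
    by (intro carrier_cstar_prodI[where M = M] nrm_cstar_prod_le nonempty theta_mem[OF a x] theta_simps; simp)+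
qed

lemma theta_coherent:
  assumes "a \<in> D" "x \<in> carrier (C a)" "theta D C \<rho> a x \<in> carrier P"
  shows "theta D C \<rho> a x \<in> coherent_families"
proof -
  have "\<forall>b\<in>D. a \<le> b \<longrightarrow> theta D C \<rho> a x b = \<rho> b a x"
    by simp
  then show ?thesis
    using assms unfolding coherent_families_def by blast
qed

text \<open>
  The coset of an element of a canonical image belongs to the quotient only if the family
  \<^const>\<open>theta\<close> is bounded; the intersection with the carrier of the quotient selects these
  cosets. Conversely a coherent family is bounded, so the family \<^const>\<open>theta\<close> with the same tail is bounded as well.
\<close>

lemma limit_images:
  "(\<Union>a\<in>D. limit_map D C \<rho> a ` carrier (C a)) \<inter> carrier Q = a_r_coset P N ` coherent_families"
proof (intro equalityI subsetI)
  fix X assume X: "X \<in> (\<Union>a\<in>D. limit_map D C \<rho> a ` carrier (C a)) \<inter> carrier Q"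
  then obtain a x where a: "a \<in> D" "x \<in> carrier (C a)" and X_eq: "X = N +>\<^bsub>P\<^esub> theta D C \<rho> a x"
    by (auto simp: limit_map_def)
  obtain F where F: "F \<in> carrier P" "X = N +>\<^bsub>P\<^esub> F"
    using X by (auto elim: null.quotE)
  \<comment> \<open>A family is a member of its own coset even before it is known to be bounded.\<close>
  have zero: "\<zero>\<^bsub>P\<^esub> \<oplus>\<^bsub>P\<^esub> theta D C \<rho> a x = theta D C \<rho> a x"
  proof (rule extensionalityI[of _ D])
    fix b assume b: "b \<in> D"
    interpret normed_star_algebra "C b"
      using b by (rule normed)
    show "(\<zero>\<^bsub>P\<^esub> \<oplus>\<^bsub>P\<^esub> theta D C \<rho> a x) b = theta D C \<rho> a x b"
      using b theta_mem[OF a b] by simp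
  qed simp_all
  have "\<zero>\<^bsub>P\<^esub> \<in> N"
    using null_eventually_zero[of "\<zero>\<^bsub>P\<^esub>" a] a(1) by simp
  then have "\<zero>\<^bsub>P\<^esub> \<oplus>\<^bsub>P\<^esub> theta D C \<rho> a x \<in> N +>\<^bsub>P\<^esub> theta D C \<rho> a x"
    unfolding a_r_coset_def' by (rule UN_I) (rule singletonI)
  then have "theta D C \<rho> a x \<in> carrier P"
    unfolding zero using null.coset_memD(1)[OF F(1)] X_eq F(2) by simp
  then have "theta D C \<rho> a x \<in> coherent_families"
    using a by (intro theta_coherent)
  then show "X \<in> a_r_coset P N ` coherent_families"
    using X_eq by blast
next
  fix X assume "X \<in> a_r_coset P N ` coherent_families"
  then obtain F a x where X: "X = N +>\<^bsub>P\<^esub> F" and F: "F \<in> carrier P"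
    and a: "a \<in> D" "x \<in> carrier (C a)" "\<And>b. \<lbrakk>b \<in> D; a \<le> b\<rbrakk> \<Longrightarrow> F b = \<rho> b a x"
    unfolding coherent_families_def by blast
  have "nrm (C b) (\<rho> b a x) \<le> nrm P F" if "b \<in> D" "a \<le> b" for b
    using nrm_le_cstar_prod[OF F that(1)] a(3)[OF that] by simp
  then have "theta D C \<rho> a x \<in> carrier P"
    using a F by (intro theta_closed(1)[where M = "nrm P F"]) auto
  then have X_eq: "X = limit_map D C \<rho> a x"
    unfolding X limit_map_def using F a by (intro coset_eqI_eventually[of _ _ a]) auto
  have "X \<in> carrier Q"
    using F by (simp add: X)
  then show "X \<in> (\<Union>a\<in>D. limit_map D C \<rho> a ` carrier (C a)) \<inter> carrier Q"
    using a(1,2) X_eq by blast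
qed

text \<open>
  The closure in the definition of the inductive limit is taken in the carrier of the quotient, so it
  only depends on the part of the union of the canonical images that lies there.
\<close>

lemma inductive_limit_eq:
  "inductive_limit D C \<rho> =
    Q\<lparr>carrier := (null.quot.metr.mtopology closure_of (a_r_coset P N ` coherent_families))\<rparr>"
proof -
  have "carrier Q \<inter> (\<Union>a\<in>D. limit_map D C \<rho> a ` carrier (C a)) = a_r_coset P N ` coherent_families"
    unfolding limit_images[symmetric] by blast
  then show ?thesis
    unfolding inductive_limit_def limit_ambient_def
    by (subst closure_of_restrict) simp
qed

lemma banach_star_algebra_inductive_limit: "banach_star_algebra (inductive_limit D C \<rho>)"
proof -
  have P: "banach_star_algebra P"
    by (rule banach_star_algebra_cstar_prod[OF banach])
  have Q: "banach_star_algebra Q"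
    by (rule null.banach_star_algebra_quot[OF banach_star_algebra.complete[OF P]])
  have "star_subalgebra Q (a_r_coset P N ` coherent_families)"
    by (rule star_subalgebra_image[OF coset_star_hom null.quot.normed_star_algebra_axioms
          star_subalgebra_coherent])
  then have "star_subalgebra Q (null.quot.metr.mtopology closure_of (a_r_coset P N ` coherent_families))"
    by (rule star_subalgebra.star_subalgebra_closure)
  then show ?thesis
    unfolding inductive_limit_eq
    by (rule star_subalgebra.banach_star_algebra_restrict[OF _ banach_star_algebra.complete[OF Q]
          closedin_closure_of])
qed

text \<open>
  The canonical map from the algebra at \<open>a\<close> is isometric, since modifying the family
  \<open>theta D C \<rho> a x\<close> by a null family changes its values far out by arbitrarily little, and those values have
  the norm of \<open>x\<close>. It reaches every coherent family: if the family is given from \<open>c \<ge> a\<close> on by an element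
  of \<open>C c\<close>, this element comes from \<open>C a\<close> by surjectivity. So the range is the dense subalgebra whose closure is
  the inductive limit, and being complete it is already closed.
\<close>

lemma inductive_limit_eventually_isometric:
  assumes a: "a \<in> D"
    and isometric: "\<And>b x. \<lbrakk>b \<in> D; a \<le> b; x \<in> carrier (C a)\<rbrakk> \<Longrightarrow> nrm (C b) (\<rho> b a x) = nrm (C a) x"
    and onto: "\<And>b. \<lbrakk>b \<in> D; a \<le> b\<rbrakk> \<Longrightarrow> \<rho> b a ` carrier (C a) = carrier (C b)"
  shows "star_isomorphic (inductive_limit D C \<rho>) (C a)"
proof -
  interpret A: banach_star_algebra "C a"
    using a by (rule banach)
  let ?\<theta> = "theta D C \<rho> a" and ?h = "limit_map D C \<rho> a"
  have \<theta>: "?\<theta> x \<in> carrier P" "nrm P (?\<theta> x) \<le> nrm (C a) x" if "x \<in> carrier (C a)" for x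
    using theta_closed[OF a that, of "nrm (C a) x"] isometric that by auto
  have h: "?h \<in> star_hom (C a) Q"
  proof (rule star_homI)
    show "?h x \<in> carrier Q" if "x \<in> carrier (C a)" for x
      using \<theta>(1)[OF that] by (simp add: limit_map_def)
    have "N +>\<^bsub>P\<^esub> ?\<theta> \<one>\<^bsub>C a\<^esub> = N +>\<^bsub>P\<^esub> \<one>\<^bsub>P\<^esub>"
      using \<theta>(1) a star_homD(4)[OF hom[OF a]] by (intro coset_eqI_eventually[of _ _ a]) auto
    then show "?h \<one>\<^bsub>C a\<^esub> = \<one>\<^bsub>Q\<^esub>"
      by (simp add: limit_map_def null.quot_one)
    fix x assume x: "x \<in> carrier (C a)"
    have "N +>\<^bsub>P\<^esub> ?\<theta> (c \<odot>\<^bsub>C a\<^esub> x) = N +>\<^bsub>P\<^esub> (c \<odot>\<^bsub>P\<^esub> ?\<theta> x)" for c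
      using \<theta>(1) a x star_homD(5)[OF hom[OF a]] by (intro coset_eqI_eventually[of _ _ a]) auto
    then show "?h (c \<odot>\<^bsub>C a\<^esub> x) = c \<odot>\<^bsub>Q\<^esub> ?h x" for c
      using \<theta>(1) x by (simp add: limit_map_def)
    have "N +>\<^bsub>P\<^esub> ?\<theta> (adj (C a) x) = N +>\<^bsub>P\<^esub> adj P (?\<theta> x)"
      using \<theta>(1) a x star_homD(6)[OF hom[OF a]] A.adj_closed
      by (intro coset_eqI_eventually[of _ _ a]) auto
    then show "?h (adj (C a) x) = adj Q (?h x)"
      using \<theta>(1) x by (simp add: limit_map_def)
    fix y assume y: "y \<in> carrier (C a)"
    have "N +>\<^bsub>P\<^esub> ?\<theta> (x \<otimes>\<^bsub>C a\<^esub> y) = N +>\<^bsub>P\<^esub> (?\<theta> x \<otimes>\<^bsub>P\<^esub> ?\<theta> y)"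
      using \<theta>(1) a x y star_homD(2)[OF hom[OF a]] by (intro coset_eqI_eventually[of _ _ a]) auto
    then show "?h (x \<otimes>\<^bsub>C a\<^esub> y) = ?h x \<otimes>\<^bsub>Q\<^esub> ?h y"
      using \<theta>(1) x y by (simp add: limit_map_def)
    have "N +>\<^bsub>P\<^esub> ?\<theta> (x \<oplus>\<^bsub>C a\<^esub> y) = N +>\<^bsub>P\<^esub> (?\<theta> x \<oplus>\<^bsub>P\<^esub> ?\<theta> y)"
      using \<theta>(1) a x y star_homD(3)[OF hom[OF a]] by (intro coset_eqI_eventually[of _ _ a]) auto
    then show "?h (x \<oplus>\<^bsub>C a\<^esub> y) = ?h x \<oplus>\<^bsub>Q\<^esub> ?h y"
      using \<theta>(1) x y by (simp add: limit_map_def)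
  qed
  have h_nrm: "nrm Q (?h x) = nrm (C a) x" if x: "x \<in> carrier (C a)" for x
  proof (rule antisym)
    show "nrm Q (?h x) \<le> nrm (C a) x"
      using null.nrm_quot_le[OF \<theta>(1)[OF x]] \<theta>(2)[OF x] by (simp add: limit_map_def)
    show "nrm (C a) x \<le> nrm Q (?h x)"
      unfolding limit_map_def
    proof (rule null.nrm_quot_greatest[OF \<theta>(1)[OF x]])
      fix F assume F: "F \<in> carrier P" "?\<theta> x \<ominus>\<^bsub>P\<^esub> F \<in> N"
      show "nrm (C a) x \<le> nrm P F"
      proof (rule field_le_epsilon)
        fix \<epsilon> :: real assume "\<epsilon> > 0"
        then obtain b where b: "b \<in> D" "\<And>d. \<lbrakk>d \<in> D; b \<le> d\<rbrakk> \<Longrightarrow> nrm (C d) ((?\<theta> x \<ominus>\<^bsub>P\<^esub> F) d) < \<epsilon>"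
          using nullD(2)[OF F(2)] by blast
        obtain c where c: "c \<in> D" "a \<le> c" "b \<le> c"
          using a b(1) by (rule upper_bound)
        interpret normed_star_algebra "C c"
          using c(1) by (rule normed)
        have "nrm (C a) x = nrm (C c) (?\<theta> x c)"
          using isometric[OF c(1,2) x] c by simp
        also have "\<dots> \<le> nrm (C c) ((?\<theta> x \<ominus>\<^bsub>P\<^esub> F) c) + nrm (C c) (F c)"
          unfolding minus_cstar_prod[OF \<theta>(1)[OF x] F(1) c(1)]
          by (intro nrm_minus_le carrier_cstar_prodD(2)[OF \<theta>(1)[OF x] c(1)]
              carrier_cstar_prodD(2)[OF F(1) c(1)])
        also have "\<dots> \<le> nrm P F + \<epsilon>"
          using b(2)[OF c(1,3)] nrm_le_cstar_prod[OF F(1) c(1)] by simp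
        finally show "nrm (C a) x \<le> nrm P F + \<epsilon>" .
      qed
    qed
  qed
  have image: "a_r_coset P N ` coherent_families = ?h ` carrier (C a)"
  proof (intro equalityI subsetI)
    fix X assume "X \<in> a_r_coset P N ` coherent_families"
    then obtain F where F: "F \<in> coherent_families" "X = N +>\<^bsub>P\<^esub> F"
      by blast
    then have carr: "F \<in> carrier P"
      by (simp add: coherent_families_def)
    obtain b where b: "b \<in> D"
      "\<forall>c\<in>D. b \<le> c \<longrightarrow> (\<exists>x\<in>carrier (C c). \<forall>d\<in>D. c \<le> d \<longrightarrow> F d = \<rho> d c x)"
      using F(1) by (rule coherent_from)
    obtain c where c: "c \<in> D" "a \<le> c" "b \<le> c"
      using a b(1) by (rule upper_bound)
    obtain y where y: "y \<in> carrier (C c)" "\<And>d. \<lbrakk>d \<in> D; c \<le> d\<rbrakk> \<Longrightarrow> F d = \<rho> d c y"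
      using b(2) c(1,3) by blast
    obtain x where x: "x \<in> carrier (C a)" "y = \<rho> c a x"
      using onto[OF c(1,2)] y(1) by blast
    have "F d = ?\<theta> x d" if d: "d \<in> D" "c \<le> d" for d
      using y(2)[OF d] comp[OF a c(1) d(1) c(2) d(2) x(1)] x(2) d c(2) order_trans[OF c(2) d(2)] by simp
    then have "X = ?h x"
      unfolding F(2) limit_map_def by (rule coset_eqI_eventually[OF carr \<theta>(1)[OF x(1)] c(1)])
    then show "X \<in> ?h ` carrier (C a)"
      using x(1) by blast
  next
    fix X assume "X \<in> ?h ` carrier (C a)"
    then obtain x where x: "x \<in> carrier (C a)" "X = N +>\<^bsub>P\<^esub> ?\<theta> x"
      by (auto simp: limit_map_def)
    have "?\<theta> x \<in> coherent_families"
      using a x(1) \<theta>(1)[OF x(1)] by (rule theta_coherent)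
    then show "X \<in> a_r_coset P N ` coherent_families"
      using x(2) by blast
  qed
  have "inductive_limit D C \<rho> = Q\<lparr>carrier := ?h ` carrier (C a)\<rparr>"
    unfolding inductive_limit_eq image
    using isometric_image_closed[OF h A.banach_star_algebra_axioms null.quot.normed_star_algebra_axioms h_nrm]
    by simp
  moreover have "inj_on ?h (carrier (C a))"
  proof (rule inj_onI)
    fix x y assume xy: "x \<in> carrier (C a)" "y \<in> carrier (C a)" "?h x = ?h y"
    have "nrm (C a) (x \<ominus>\<^bsub>C a\<^esub> y) = nrm Q (?h x \<ominus>\<^bsub>Q\<^esub> ?h y)"
      using h_nrm[of "x \<ominus>\<^bsub>C a\<^esub> y"] xy(1,2) star_hom_minus[OF h A.normed_star_algebra_axioms
          null.quot.normed_star_algebra_axioms xy(1,2)] by simp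
    also have "\<dots> = 0"
      using xy star_homD(1)[OF h xy(2)] by simp
    finally show "x = y"
      using xy(1,2) by (simp add: A.nrm_eq_0_iff)
  qed
  ultimately show ?thesis
    using star_isomorphic_image[OF h A.normed_star_algebra_axioms] by simp
qed

end

section \<open>Isolated points of the index space\<close>

lemma star_isomorphic_cstar_prod_singleton: "star_isomorphic (cstar_prod {i} L) (L i)"
proof -
  let ?h = "\<lambda>F. F i"
  have mem: "(\<lambda>j\<in>{i}. x) \<in> carrier (cstar_prod {i} L)" if "x \<in> carrier (L i)" for x
    using that by (intro carrier_cstar_prodI[where M = "nrm (L i) x"]) auto
  have "?h \<in> star_hom (cstar_prod {i} L) (L i)"
    by (rule star_homI) (auto dest: carrier_cstar_prodD(2))
  moreover have "bij_betw ?h (carrier (cstar_prod {i} L)) (carrier (L i))"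
  proof (rule bij_betw_byWitness[where f' = "\<lambda>x. \<lambda>j\<in>{i}. x"])
    show "\<forall>F\<in>carrier (cstar_prod {i} L). (\<lambda>j\<in>{i}. F i) = F"
      using carrier_cstar_prodD(1) by (auto intro!: extensionalityI[of _ "{i}"])
  qed (use mem in \<open>auto dest: carrier_cstar_prodD(2)\<close>)
  ultimately show ?thesis
    unfolding star_isomorphic_def by blast
qed

text \<open>
  An open singleton is a union of basic sets, one of which contains the point and hence equals it.
\<close>

lemma isolated_index_nhd:
  assumes K: "\<And>j. j \<in> I \<Longrightarrow> maximal_directed (K j)"
    and isolated: "openin (index_topology I K) {i}"
  obtains a where "index_nhd I K a = {i}"
proof -
  have "(arbitrary union_of (\<lambda>S. S \<in> range (index_nhd I K))) {i}"
    using isolated openin_index_topology[of I K, OF K] by simp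
  then obtain \<U> where \<U>: "\<U> \<subseteq> range (index_nhd I K)" "\<Union> \<U> = {i}"
    by (auto simp: union_of_def)
  then obtain U where "U \<in> \<U>" "i \<in> U" by blast
  with \<U> have "U = {i}" "U \<in> range (index_nhd I K)" by blast+
  then show thesis
    using that by (metis rangeE)
qed

theorem theorem2:
  fixes A :: "'k::order \<Rightarrow> 'x cstar"
    and \<sigma> :: "'k \<Rightarrow> 'k \<Rightarrow> 'x \<Rightarrow> 'x"
    and I :: "'i set"
    and K :: "'i \<Rightarrow> 'k set"
    and i :: 'i
  assumes K: "bij_betw K I {S. maximal_directed S}"
    and A: "inductive_system UNIV A \<sigma>"
    and inj: "\<And>a b. a \<le> b \<Longrightarrow> inj_on (\<sigma> b a) (carrier (A a))"
    and i: "i \<in> I"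
    and isolated: "openin (index_topology I K) {i}"
  shows "star_isomorphic (derived_limit_algebra A \<sigma> I K i) (limit_algebra A \<sigma> K i)"
proof -
  have max: "maximal_directed (K j)" if "j \<in> I" for j
    using bij_betwE[OF K] that by blast
  have L: "banach_star_algebra (limit_algebra A \<sigma> K j)" if j: "j \<in> I" for j
  proof -
    have "star_system (K j) A \<sigma>"
    proof (rule star_system.intro)
      show "upward_directed (K j)"
        using max[OF j] by (simp add: maximal_directed_def)
      show "banach_star_algebra (A a)" for a
      proof -
        interpret unital_cstar_algebra "A a"
          using A by (simp add: inductive_system_def)
        show ?thesis by (rule banach_star_algebra_axioms)
      qed
      show "\<sigma> b a \<in> star_hom (A a) (A b)" if "a \<le> b" for a b
        using A that unfolding inductive_system_def by blast
      show "\<sigma> c a x = \<sigma> c b (\<sigma> b a x)" if "a \<le> b" "b \<le> c" "x \<in> carrier (A a)" for a b c x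
        using A that unfolding inductive_system_def by blast
    qed
    then show ?thesis
      unfolding limit_algebra_def by (rule star_system.banach_star_algebra_inductive_limit)
  qed
  have antimono: "index_nhd I K b \<subseteq> index_nhd I K a" if "a \<le> b" for a b
    using maximal_directed_downward[OF max _ that] by (auto simp: index_nhd_def)
  interpret B: star_system "K i" "derived_algebra A \<sigma> I K" "derived_map I K"
  proof (rule star_system.intro)
    show "upward_directed (K i)"
      using max[OF i] by (simp add: maximal_directed_def)
    show "banach_star_algebra (derived_algebra A \<sigma> I K a)" if "a \<in> K i" for a
      unfolding derived_algebra_def
    proof (rule star_algebra_family.banach_star_algebra_cstar_prod)
      show "star_algebra_family (index_nhd I K a) (limit_algebra A \<sigma> K)"
        using that i L by (auto simp: star_algebra_family_def index_nhd_def
            dest: banach_star_algebra.axioms(1))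
    qed (use L in \<open>auto simp: index_nhd_def\<close>)
    show "derived_map I K b a \<in> star_hom (derived_algebra A \<sigma> I K a) (derived_algebra A \<sigma> I K b)"
      if "a \<le> b" for a b
      using restrict_star_hom[OF antimono[OF that]] by (simp add: derived_algebra_def derived_map_def [abs_def])
    show "derived_map I K c a x = derived_map I K c b (derived_map I K b a x)" if "b \<le> c" for a b c x
      using antimono[OF that] by (simp add: derived_map_def Int_absorb1)
  qed
  obtain a where a: "index_nhd I K a = {i}"
    using isolated_index_nhd[OF max isolated] .
  have single: "index_nhd I K b = {i}" if "b \<in> K i" "a \<le> b" for b
    using antimono[OF that(2)] a that(1) i by (auto simp: index_nhd_def)
  have "a \<in> K i"
    using a by (auto simp: index_nhd_def)
  have id: "derived_map I K b a x = x" if "b \<in> K i" "a \<le> b" "x \<in> carrier (derived_algebra A \<sigma> I K a)" for b x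
    using that(3) carrier_cstar_prodD(1) single[OF that(1,2)] a
    by (auto simp: derived_map_def derived_algebra_def intro: extensional_restrict)
  have eq: "derived_algebra A \<sigma> I K b = derived_algebra A \<sigma> I K a" if "b \<in> K i" "a \<le> b" for b
    using single[OF that] a by (simp add: derived_algebra_def)
  have "star_isomorphic (derived_limit_algebra A \<sigma> I K i) (derived_algebra A \<sigma> I K a)"
    unfolding derived_limit_algebra_def
  proof (rule B.inductive_limit_eventually_isometric[OF \<open>a \<in> K i\<close>])
    show "derived_map I K b a ` carrier (derived_algebra A \<sigma> I K a) = carrier (derived_algebra A \<sigma> I K b)"
      if "b \<in> K i" "a \<le> b" for b
      using id[OF that] eq[OF that] by (simp cong: image_cong)
  qed (simp add: id eq)
  moreover have "star_isomorphic (derived_algebra A \<sigma> I K a) (limit_algebra A \<sigma> K i)"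
    using star_isomorphic_cstar_prod_singleton[of i] by (simp add: derived_algebra_def a)
  ultimately show ?thesis
    by (rule star_isomorphic_trans)
qed

end
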